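(* Let $\mathcal X$ be a symplectic leaf (surface of revolution) homeomorphic to the cylinder, with complex coordinate $z$ (functions being $2\pi i$-periodic in $z$), Kähler form $\omega=i\hbar\,\bar\partial\partial\ln\mathcal K$, where $\mathcal K(\bar z|z)=\theta(\bar z+z-\hbar,e^{-\hbar})$, and reproducing measure $dm=\frac12\theta\big(\frac{i\pi}\hbar(\bar z+z-\hbar),e^{-\pi^2/\hbar}\big)d\bar z\,dz$. Let $\omega_0=\frac i2d\bar z\wedge dz$ be the classical symplectic form on the leaf and $dm^{\omega_0}=\frac12d\bar z\,dz$ the classical Liouville measure. Then, as $\hbar\to0$, $$\omega=\omega_0+i\hbar\,\bar\partial\partial\ln\theta\Big(\frac{i\pi(\bar z+z-\hbar)}\hbar,e^{-\pi^2/\hbar}\Big)=\omega_0+O(e^{-\pi^2/\hbar}),$$ $$dm=dm^{\omega_0}+O(e^{-\pi^2/\hbar}).$$ The exponentially small remainders $O(e^{-\pi^2/\hbar})$ here are not zero and are explicitly given by the theta-series.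
   Context: Here $\hbar>0$ and $\theta(\alpha,q)=\sum_{n\in\mathbb Z}q^{n^2}e^{n\alpha}$ for $q<1$. The leaf: let $A=(A_1,\dots,A_k)$ be coordinates in $\mathbb R^k$, $S_1,S_2$ further real coordinates, $C=\bar B=S_1+iS_2$; let $\rho$ and the independent functions $\varkappa_1,\dots,\varkappa_{k-1}$ be polynomials on $\mathbb R^k$, and $v$ a vector field on $\mathbb R^k$ annulling all $\varkappa_j$, whose flow $\gamma^t$ preserves polynomials. The space $\mathbb R^{k+2}$ carries the Poisson brackets $\{C,B\}=i\lambda(A)$, $\{C,A_\mu\}=iv_\mu(A)C$, $\{A_\mu,A_\nu\}=0$ with $\lambda=v(\rho)$, and $\mathcal X=\{\rho(A)-BC=K,\ \varkappa_j(A)=\mathrm{const}_j\ (j=1,\dots,k-1)\}$ is a symplectic leaf with $K<\min\rho$. Fix $a_0$ with $\varkappa_j(a_0)=\mathrm{const}_j$; the trajectory $\{\gamma^t(a_0)\}$ is assumed not periodic, so that $\mathcal X$ is homeomorphic to the cylinder. It is assumed that there are a polynomial $g$ with $g(\gamma^t(a_0))=g(a_0)=K$ for all $t$ and $\rho>g$ in a neighborhood of $\mathcal X$, and a complex polynomial $M$ with $\rho(A)-g(A)=|M(A)|^2$; the complex coordinate on $\mathcal X$ is defined by $e^z=Ce^{t(A)}/\overline{M(A)}$, where $t(A)$ is the time along trajectories of $\gamma^t$. That $dm$ is the reproducing measure corresponding to $\omega$ means that $\mathcal K$ is the reproducing kernel of the space of antiholomorphic $2\pi i$-periodic functions $u$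 with norm $\|u\|^2=\frac1{2\pi\hbar}\int_{0<\operatorname{Im}z<2\pi}\frac{|u|^2}{\mathcal K}\,dm$, and $\omega=i\hbar\,\bar\partial\partial\ln\mathcal K$.
   Formalization: The remainder in ω is false pointwise as O(e^{-π²/ħ}) (at Re z=0 it is about (4π²/ħ)e^{-π²/ħ}); it is bounded instead by O(ħ^{-1}e^{-π²/ħ}) uniformly in z, and by O(e^{-π²/ħ}) for integrals over coordinate rectangles (relative to the Im z-width). *)

theory Defs
  imports "HOL-Analysis.Analysis"
begin

section \<open>The theta function\<close>

definition theta :: "complex \<Rightarrow> real \<Rightarrow> complex" where
  "theta \<alpha> q = (\<Sum>\<^sub>\<infinity>n\<in>(UNIV :: int set). of_real (q powi (n\<^sup>2)) * exp (of_int n * \<alpha>))"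

definition theta_tail :: "complex \<Rightarrow> real \<Rightarrow> complex" where
  "theta_tail \<alpha> q = (\<Sum>\<^sub>\<infinity>n\<in>(UNIV - {0 :: int}). of_real (q powi (n\<^sup>2)) * exp (of_int n * \<alpha>))"

section \<open>The Poisson space and its symplectic leaves\<close>

text \<open>
  The space \<open>\<real>\<^sup>k\<^sup>+\<^sup>2\<close> is \<open>(real^'k) \<times> complex\<close>; a point is a pair \<open>(A, C)\<close> with
  \<open>C = S1 + i S2\<close> and \<open>B = cnj C\<close>.
\<close>

type_synonym 'k pspace = "(real^'k) \<times> complex"

definition lie_deriv :: "(real^'k \<Rightarrow> real^'k) \<Rightarrow> (real^'k \<Rightarrow> real) \<Rightarrow> real^'k \<Rightarrow> real" where
  "lie_deriv v f A = frechet_derivative f (at A) (v A)"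

definition d_A :: "'k \<Rightarrow> ('k::finite pspace \<Rightarrow> complex) \<Rightarrow> 'k pspace \<Rightarrow> complex" where
  "d_A \<mu> f p = frechet_derivative f (at p) (axis \<mu> 1, 0)"

definition d_C :: "('k::finite pspace \<Rightarrow> complex) \<Rightarrow> 'k pspace \<Rightarrow> complex" where
  "d_C f p = (frechet_derivative f (at p) (0, 1) - \<i> * frechet_derivative f (at p) (0, \<i>)) / 2"

definition d_B :: "('k::finite pspace \<Rightarrow> complex) \<Rightarrow> 'k pspace \<Rightarrow> complex" where
  "d_B f p = (frechet_derivative f (at p) (0, 1) + \<i> * frechet_derivative f (at p) (0, \<i>)) / 2"

text \<open>
  The biderivation determined by \<open>{C,B} = i \<lambda>(A)\<close> with \<open>\<lambda> = v(\<rho>)\<close>,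
  \<open>{C,A\<^sub>\<mu>} = i v\<^sub>\<mu>(A) C\<close>, hence \<open>{B,A\<^sub>\<mu>} = - i v\<^sub>\<mu>(A) B\<close>, and \<open>{A\<^sub>\<mu>,A\<^sub>\<nu>} = 0\<close>
  (see the lemmas below).
\<close>

definition poisson ::
  "(real^'k \<Rightarrow> real^'k) \<Rightarrow> (real^'k \<Rightarrow> real)
    \<Rightarrow> ('k::finite pspace \<Rightarrow> complex) \<Rightarrow> ('k pspace \<Rightarrow> complex) \<Rightarrow> 'k pspace \<Rightarrow> complex" where
  "poisson v \<rho> f g p =
     \<i> * of_real (lie_deriv v \<rho> (fst p)) * (d_C f p * d_B g p - d_B f p * d_C g p)
     + (\<Sum>\<mu>\<in>UNIV. \<i> * of_real (v (fst p) $ \<mu>) * snd p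
           * (d_C f p * d_A \<mu> g p - d_A \<mu> f p * d_C g p))
     + (\<Sum>\<mu>\<in>UNIV. - \<i> * of_real (v (fst p) $ \<mu>) * cnj (snd p)
           * (d_B f p * d_A \<mu> g p - d_A \<mu> f p * d_B g p))"

definition cplx :: "('a \<Rightarrow> real) \<Rightarrow> 'a \<Rightarrow> complex" where
  "cplx f = (\<lambda>p. complex_of_real (f p))"

abbreviation coord_A :: "'k \<Rightarrow> 'k::finite pspace \<Rightarrow> complex" where
  "coord_A \<mu> \<equiv> cplx (\<lambda>p. fst p $ \<mu>)"

text \<open>The Hamiltonian field \<open>{f, _}\<close> of a real function \<open>f\<close>.\<close>

definition ham_field ::
  "(real^'k \<Rightarrow> real^'k) \<Rightarrow> (real^'k \<Rightarrow> real) \<Rightarrow> ('k::finite pspace \<Rightarrow> real)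
    \<Rightarrow> 'k pspace \<Rightarrow> 'k pspace" where
  "ham_field v \<rho> f p =
     ((\<chi> \<mu>. Re (poisson v \<rho> (cplx f) (coord_A \<mu>) p)), poisson v \<rho> (cplx f) snd p)"

text \<open>
  A symplectic leaf is a class of points that can be joined by piecewise Hamiltonian
  trajectories. Polynomial Hamiltonians suffice: their differentials exhaust every
  cotangent space.
\<close>

definition ham_step ::
  "(real^'k \<Rightarrow> real^'k) \<Rightarrow> (real^'k \<Rightarrow> real) \<Rightarrow> 'k::finite pspace \<Rightarrow> 'k pspace \<Rightarrow> bool" where
  "ham_step v \<rho> p q \<longleftrightarrow>
     (\<exists>f c. real_polynomial_function f \<and> c 0 = p \<and> c 1 = q \<and>
        (\<forall>s\<in>{0..1}. (c has_vector_derivative ham_field v \<rho> f (c s)) (at s within {0..1})))"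

definition symplectic_leaf ::
  "(real^'k \<Rightarrow> real^'k) \<Rightarrow> (real^'k \<Rightarrow> real) \<Rightarrow> 'k::finite pspace set \<Rightarrow> bool" where
  "symplectic_leaf v \<rho> X \<longleftrightarrow> (\<exists>p. X = {q. (ham_step v \<rho>)\<^sup>*\<^sup>* p q})"

text \<open>
  The symplectic form of a leaf: \<open>\<omega>\<^sub>0(X\<^sub>f, X\<^sub>g) = {f, g}\<close>. It is meaningful for vectors
  \<open>a\<close>, \<open>b\<close> tangent to the leaf at \<open>p\<close>, i.e. for values of Hamiltonian fields.
\<close>

definition leaf_symplectic_form ::
  "(real^'k \<Rightarrow> real^'k) \<Rightarrow> (real^'k \<Rightarrow> real)
    \<Rightarrow> 'k::finite pspace \<Rightarrow> 'k pspace \<Rightarrow> 'k pspace \<Rightarrow> real" where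
  "leaf_symplectic_form v \<rho> p a b =
     (THE r. \<exists>f g. real_polynomial_function f \<and> real_polynomial_function g \<and>
        ham_field v \<rho> f p = a \<and> ham_field v \<rho> g p = b \<and>
        poisson v \<rho> (cplx f) (cplx g) p = of_real r)"

section \<open>The cylindrical leaf and its complex coordinate\<close>

definition complete_flow :: "('a::real_normed_vector \<Rightarrow> 'a) \<Rightarrow> (real \<Rightarrow> 'a \<Rightarrow> 'a) \<Rightarrow> bool" where
  "complete_flow v \<gamma> \<longleftrightarrow>
     (\<forall>a. \<gamma> 0 a = a) \<and> (\<forall>s t a. \<gamma> (s + t) a = \<gamma> s (\<gamma> t a)) \<and>
     (\<forall>a t. ((\<lambda>t. \<gamma> t a) has_vector_derivative v (\<gamma> t a)) (at t))"

definition independent_at :: "'j set \<Rightarrow> ('j \<Rightarrow> real^'k \<Rightarrow> real) \<Rightarrow> real^'k::finite \<Rightarrow> bool" where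
  "independent_at J \<kappa> A \<longleftrightarrow>
     (\<forall>c. (\<forall>w. (\<Sum>j\<in>J. c j * frechet_derivative (\<kappa> j) (at A) w) = (0::real)) \<longrightarrow> (\<forall>j\<in>J. c j = 0))"

locale cylindrical_leaf =
  fixes v :: "real^'k::finite \<Rightarrow> real^'k"
    and \<rho> :: "real^'k \<Rightarrow> real"
    and \<kappa> :: "nat \<Rightarrow> real^'k \<Rightarrow> real"
    and \<gamma> :: "real \<Rightarrow> real^'k \<Rightarrow> real^'k"
    and K :: real
    and a0 :: "real^'k"
    and g :: "real^'k \<Rightarrow> real"
    and M :: "real^'k \<Rightarrow> complex"
    and X :: "'k pspace set"
  assumes rho_poly: "real_polynomial_function \<rho>"
    and kappa_poly: "\<And>j. j \<in> {1..<CARD('k)} \<Longrightarrow> real_polynomial_function (\<kappa> j)"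
    and kappa_independent: "closure {A. independent_at {1..<CARD('k)} \<kappa> A} = UNIV"
    and v_C1: "\<exists>v'. continuous_on UNIV v' \<and>
                 (\<forall>A. (v has_derivative blinfun_apply (v' A)) (at A))"
    and v_annuls: "\<And>j A. j \<in> {1..<CARD('k)} \<Longrightarrow> lie_deriv v (\<kappa> j) A = 0"
    and flow: "complete_flow v \<gamma>"
    and flow_poly: "\<And>f t. real_polynomial_function f \<Longrightarrow> real_polynomial_function (\<lambda>A. f (\<gamma> t A))"
    and X_def: "X = {(A, C). of_real (\<rho> A) - cnj C * C = complex_of_real K \<and>
                       (\<forall>j\<in>{1..<CARD('k)}. \<kappa> j A = \<kappa> j a0)}"
    and X_leaf: "symplectic_leaf v \<rho> X"
    and K_less: "\<And>A. (\<forall>j\<in>{1..<CARD('k)}. \<kappa> j A = \<kappa> j a0) \<Longrightarrow> K < \<rho> A"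
    and not_periodic: "\<And>t. t \<noteq> 0 \<Longrightarrow> \<gamma> t a0 \<noteq> a0"
    and X_cylinder: "X homeomorphic ((UNIV :: real set) \<times> sphere (0::complex) 1)"
    and g_poly: "real_polynomial_function g"
    and g_orbit: "\<And>t. g (\<gamma> t a0) = K" "g a0 = K"
    and g_less: "\<exists>U. open U \<and> X \<subseteq> U \<and> (\<forall>(A, C)\<in>U. g A < \<rho> A)"
    and M_poly: "polynomial_function M"
    and M_factor: "\<And>A. \<rho> A - g A = (cmod (M A))\<^sup>2"

definition leaf_time :: "(real \<Rightarrow> 'a \<Rightarrow> 'a) \<Rightarrow> 'a \<Rightarrow> 'a \<Rightarrow> real" where
  "leaf_time \<gamma> a0 A = (THE t. \<gamma> t a0 = A)"

definition leaf_exp ::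
  "(real \<Rightarrow> real^'k \<Rightarrow> real^'k) \<Rightarrow> real^'k \<Rightarrow> (real^'k \<Rightarrow> complex) \<Rightarrow> 'k::finite pspace \<Rightarrow> complex" where
  "leaf_exp \<gamma> a0 M = (\<lambda>(A, C). C * exp (of_real (leaf_time \<gamma> a0 A)) / cnj (M A))"

text \<open>The point of the leaf with complex coordinate \<open>z\<close> (determined modulo \<open>2\<pi>i\<close>).\<close>

definition leaf_point ::
  "'k::finite pspace set \<Rightarrow> (real \<Rightarrow> real^'k \<Rightarrow> real^'k) \<Rightarrow> real^'k \<Rightarrow> (real^'k \<Rightarrow> complex)
    \<Rightarrow> complex \<Rightarrow> 'k pspace" where
  "leaf_point X \<gamma> a0 M z = (THE p. p \<in> X \<and> exp z = leaf_exp \<gamma> a0 M p)"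

section \<open>Forms and measures in the coordinate \<open>z\<close>\<close>

text \<open>
  A (complex) two-form on the leaf is given in the coordinate \<open>z\<close> as a function of the
  point \<open>z\<close> and of two tangent vectors \<open>a\<close>, \<open>b\<close> in \<open>\<complex> = \<real>\<^sup>2\<close>.
\<close>

type_synonym two_form = "complex \<Rightarrow> complex \<Rightarrow> complex \<Rightarrow> complex"

definition dzbar_dz :: "complex \<Rightarrow> complex \<Rightarrow> complex" where
  "dzbar_dz a b = cnj a * b - cnj b * a"

definition d_z :: "(complex \<Rightarrow> complex) \<Rightarrow> complex \<Rightarrow> complex" where
  "d_z F z = (frechet_derivative F (at z) 1 - \<i> * frechet_derivative F (at z) \<i>) / 2"

definition d_zbar :: "(complex \<Rightarrow> complex) \<Rightarrow> complex \<Rightarrow> complex" where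
  "d_zbar F z = (frechet_derivative F (at z) 1 + \<i> * frechet_derivative F (at z) \<i>) / 2"

text \<open>The form \<open>\<partial>\<close>-bar \<open>\<partial> F\<close>.\<close>

definition dbar_d :: "(complex \<Rightarrow> complex) \<Rightarrow> two_form" where
  "dbar_d F z a b = d_zbar (d_z F) z * dzbar_dz a b"

text \<open>The pullback of the leaf's own symplectic form to the \<open>z\<close>-plane.\<close>

definition classical_form ::
  "(real^'k \<Rightarrow> real^'k) \<Rightarrow> (real^'k \<Rightarrow> real) \<Rightarrow> (real \<Rightarrow> real^'k \<Rightarrow> real^'k) \<Rightarrow> real^'k
    \<Rightarrow> (real^'k \<Rightarrow> complex) \<Rightarrow> 'k::finite pspace set \<Rightarrow> two_form" where
  "classical_form v \<rho> \<gamma> a0 M X z a b =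
     of_real (leaf_symplectic_form v \<rho> (leaf_point X \<gamma> a0 M z)
       (frechet_derivative (leaf_point X \<gamma> a0 M) (at z) a)
       (frechet_derivative (leaf_point X \<gamma> a0 M) (at z) b))"

text \<open>
  The measure defined by a two-form \<open>\<eta> = \<eta>(1,i) dx \<and> dy\<close>. In particular
  \<open>1/2 d\<close>z-bar \<open>dz\<close> is Lebesgue measure \<open>dx dy\<close>.
\<close>

definition form_measure :: "two_form \<Rightarrow> complex measure" where
  "form_measure \<eta> = density lborel (\<lambda>z. ennreal (cmod (\<eta> z 1 \<i>)))"

section \<open>Reproducing measures\<close>

definition period_strip :: "complex set" where
  "period_strip = {z. 0 < Im z \<and> Im z < 2 * pi}"

text \<open>
  In what follows \<open>Ker w z\<close> stands for \<open>\<K>\<close>(w-bar|z); it is holomorphic in \<open>z\<close> and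
  antiholomorphic in \<open>w\<close>.
\<close>

definition antihol_space ::
  "(complex \<Rightarrow> complex \<Rightarrow> complex) \<Rightarrow> complex measure \<Rightarrow> (complex \<Rightarrow> complex) set" where
  "antihol_space Ker m =
     {u. (\<lambda>z. cnj (u z)) holomorphic_on UNIV \<and> (\<forall>z. u (z + 2 * pi * \<i>) = u z) \<and>
         set_integrable m period_strip (\<lambda>z. of_real ((cmod (u z))\<^sup>2) / Ker z z)}"

definition antihol_inner ::
  "real \<Rightarrow> (complex \<Rightarrow> complex \<Rightarrow> complex) \<Rightarrow> complex measure
    \<Rightarrow> (complex \<Rightarrow> complex) \<Rightarrow> (complex \<Rightarrow> complex) \<Rightarrow> complex" where
  "antihol_inner h Ker m u w =
     1 / (2 * pi * h) * (LINT z:period_strip|m. u z * cnj (w z) / Ker z z)"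

definition reproducing_kernel ::
  "real \<Rightarrow> (complex \<Rightarrow> complex \<Rightarrow> complex) \<Rightarrow> complex measure \<Rightarrow> bool" where
  "reproducing_kernel h Ker m \<longleftrightarrow>
     (\<forall>w. (\<lambda>z. Ker z w) \<in> antihol_space Ker m \<and>
          (\<forall>u\<in>antihol_space Ker m. antihol_inner h Ker m u (\<lambda>z. Ker z w) = u w))"

definition kahler_form :: "real \<Rightarrow> (complex \<Rightarrow> complex \<Rightarrow> complex) \<Rightarrow> two_form" where
  "kahler_form h Ker z a b = \<i> * of_real h * dbar_d (\<lambda>z. ln (Ker z z)) z a b"

text \<open>\<open>m\<close> is the reproducing measure corresponding to the Kaehler form \<open>\<omega>\<close> with kernel \<open>Ker\<close>.\<close>

definition reproducing_measure ::
  "real \<Rightarrow> (complex \<Rightarrow> complex \<Rightarrow> complex) \<Rightarrow> two_form \<Rightarrow> complex measure \<Rightarrow> bool" where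
  "reproducing_measure h Ker \<omega> m \<longleftrightarrow> \<omega> = kahler_form h Ker \<and> reproducing_kernel h Ker m"

section \<open>The bracket relations\<close>

lemma frechet_cplx_A:
  "frechet_derivative (coord_A \<mu>) (at p) = (\<lambda>q. complex_of_real (fst q $ \<mu>))"
proof -
  have "bounded_linear (\<lambda>q :: 'a::finite pspace. complex_of_real (fst q $ \<mu>))"
    by (intro bounded_linear_compose[OF bounded_linear_of_real]
        bounded_linear_compose[OF bounded_linear_vec_nth] bounded_linear_fst)
  then show ?thesis
    unfolding cplx_def by (metis bounded_linear_imp_has_derivative frechet_derivative_at)
qed

lemma frechet_C: "frechet_derivative (snd :: 'k::finite pspace \<Rightarrow> complex) (at p) = snd"
  by (metis bounded_linear_imp_has_derivative bounded_linear_snd frechet_derivative_at)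

lemma frechet_B:
  "frechet_derivative (\<lambda>p :: 'k::finite pspace. cnj (snd p)) (at p) = (\<lambda>q. cnj (snd q))"
proof -
  have "bounded_linear (\<lambda>q :: 'k pspace. cnj (snd q))"
    by (intro bounded_linear_compose[OF bounded_linear_cnj] bounded_linear_snd)
  then show ?thesis
    by (metis bounded_linear_imp_has_derivative frechet_derivative_at)
qed

lemma poisson_C_B:
  "poisson v \<rho> snd (\<lambda>p. cnj (snd p)) p = \<i> * of_real (lie_deriv v \<rho> (fst p))"
  by (simp add: poisson_def d_A_def d_B_def d_C_def frechet_C frechet_B)

lemma poisson_C_A:
  "poisson v \<rho> snd (coord_A \<mu>) p = \<i> * of_real (v (fst p) $ \<mu>) * snd p"
  by (simp add: poisson_def d_A_def d_B_def d_C_def frechet_C frechet_cplx_A axis_def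
      if_distrib if_distribR cong: if_cong)

lemma poisson_A_A: "poisson v \<rho> (coord_A \<mu>) (coord_A \<nu>) p = 0"
  by (simp add: poisson_def d_A_def d_B_def d_C_def frechet_cplx_A)

end

theory Submission
  imports Defs "HOL-Probability.Probability" "HOL-Real_Asymp.Real_Asymp"
begin

text \<open>
  The classical form. Every Hamiltonian field moves \<open>A\<close> along \<open>v\<close>, so a leaf lies over one
  trajectory \<open>\<gamma>\<^sup>t(a\<^sub>0)\<close> (\<open>ham_step_flow\<close>). On it \<open>BC = \<rho> - K = \<rho> - g = |M|\<^sup>2\<close>, and therefore
  \<open>e\<^sup>z = Ce\<^sup>t\<close> divided by the conjugate of \<open>M\<close> has modulus \<open>e\<^sup>t\<close>: the real part of \<open>z\<close> is the time
  along the trajectory and its imaginary part is the phase of \<open>C M\<close>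
  (\<open>leaf_point_eq\<close>). Two Hamiltonian fields \<open>(s v, w)\<close> and \<open>(s' v, w')\<close> have bracket
  \<open>s' Im(w/C) - s Im(w'/C)\<close> (\<open>poisson_of_ham_fields\<close>); inserting the coordinate fields gives
  \<open>-dx \<and> dy\<close>, that is \<open>i/2\<close> times \<open>d\<close>z-bar \<open>\<and> dz\<close> (\<open>classical_form_eq\<close>).

  The quantum corrections. On the diagonal the kernel is a theta series with the real argument
  \<open>2x - \<hbar>\<close>, \<open>x = Re z\<close>. Jacobi's inversion formula (\<open>theta_real\<close>) turns it into the Gaussian
  factor \<open>exp((2x - \<hbar>)\<^sup>2/4\<hbar>)\<close> times a constant and times the dual series, whose nome is
  \<open>q = e\<close> to the power \<open>-\<pi>\<^sup>2/\<hbar>\<close>. The Gaussian contributes exactly the classical form, so the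
  correction is the second logarithmic derivative of the dual series, while the measure has the dual
  series itself as its density. The dual series is \<open>1\<close> plus a cosine series whose derivatives
  are all \<open>O(q)\<close> (\<open>tail_deriv_bound\<close>). The pointwise bound on the form carries a factor
  \<open>1/\<hbar>\<close>, since two derivatives in \<open>x\<close> produce \<open>\<hbar>\<^sup>-\<^sup>2\<close> and the form only supplies one
  \<open>\<hbar>\<close>; integrating over a box undoes one derivative and with it this factor. The remainders do not
  vanish because the cosine series differs at \<open>0\<close> and \<open>\<pi>\<close>.

  Jacobi's formula is Poisson summation for the Gaussian. The periodized Gaussian and the dual
  series are continuous and periodic with proportional Fourier coefficients (\<open>gaussian_fourier\<close>,
  \<open>periodization_integral\<close>), and a continuous periodic function without Fourier coefficients is
  zero (\<open>vanishing_fourier_imp_zero\<close>). As a by-product the dual series is positive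
  (\<open>dual_theta_pos\<close>), which makes its logarithm and the density meaningful for every \<open>\<hbar>\<close>.
\<close>

section \<open>Hamiltonian fields\<close>

text \<open>
  The factor \<open>\<phi>\<close> is the speed at which a Hamiltonian trajectory runs along the orbit of \<open>v\<close>.
  Gronwall's argument: on a ball containing both curves \<open>v\<close> is Lipschitz, and the squared distance,
  damped by a sufficiently fast exponential, does not increase.
\<close>
lemma ode_unique:
  fixes v :: "'a::euclidean_space \<Rightarrow> 'a"
  assumes v: "\<exists>v'. continuous_on UNIV v' \<and> (\<forall>A. (v has_derivative blinfun_apply (v' A)) (at A))"
    and \<phi>: "continuous_on {0..1} \<phi>"
    and c: "\<And>s. s \<in> {0..1} \<Longrightarrow> (c has_vector_derivative \<phi> s *\<^sub>R v (c s)) (at s within {0..1})"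
    and d: "\<And>s. s \<in> {0..1} \<Longrightarrow> (d has_vector_derivative \<phi> s *\<^sub>R v (d s)) (at s within {0..1})"
    and init: "c 0 = d 0"
  shows "c 1 = d (1 :: real)"
proof -
  obtain v' where v': "continuous_on UNIV v'" "\<And>A. (v has_derivative blinfun_apply (v' A)) (at A)"
    using v by blast
  have cc: "continuous_on {0..1} c" and cd: "continuous_on {0..1} d"
    using c d by (meson continuous_on_eq_continuous_within has_vector_derivative_continuous)+
  have "bounded (c ` {0..1} \<union> d ` {0..1})"
    using compact_continuous_image[OF cc] compact_continuous_image[OF cd] compact_imp_bounded by auto
  then obtain R where "\<forall>x \<in> c ` {0..1} \<union> d ` {0..1}. norm x \<le> R"
    unfolding bounded_iff by blast
  then have R: "c s \<in> cball 0 R \<and> d s \<in> cball 0 R" if "s \<in> {0..1}" for s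
    using that by auto
  have "bounded (v' ` cball 0 R)"
    by (intro compact_imp_bounded compact_continuous_image continuous_on_subset[OF v'(1)]) auto
  then obtain L where L: "L > 0" "\<And>x. x \<in> cball 0 R \<Longrightarrow> norm (v' x) \<le> L"
    unfolding bounded_pos by auto
  have lip: "norm (v x - v y) \<le> L * norm (x - y)" if "x \<in> cball 0 R" "y \<in> cball 0 R" for x y
    using differentiable_bound[of "cball 0 R" v "\<lambda>x. blinfun_apply (v' x)" L x y] that L(2)
    by (auto intro: has_derivative_at_withinI[OF v'(2)] simp: norm_blinfun.rep_eq)
  have "bounded (\<phi> ` {0..1})" using compact_continuous_image[OF \<phi>] compact_imp_bounded by blast
  then obtain P where P: "P > 0" "\<And>s. s \<in> {0..1} \<Longrightarrow> \<bar>\<phi> s\<bar> \<le> P"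
    unfolding bounded_pos by auto
  \<comment> \<open>\<open>P L\<close> is a Lipschitz constant of the right-hand side; the square of the distance doubles the rate.\<close>
  define u where "u s = ((c s - d s) \<bullet> (c s - d s)) * exp (- (2 * P * L) * s)" for s
  have "u 1 \<le> u 0"
  proof (rule DERIV_nonpos_imp_decreasing_open[of 0 1 u])
    show "continuous_on {0..1} u" unfolding u_def by (intro continuous_intros cc cd)
    fix s :: real assume s: "0 < s" "s < 1"
    then have at: "at s within {0..1} = at s" by (simp add: at_within_Icc_at)
    let ?e = "c s - d s" and ?w = "\<phi> s *\<^sub>R v (c s) - \<phi> s *\<^sub>R v (d s)"
    have e: "((\<lambda>s. c s - d s) has_vector_derivative ?w) (at s)"
      using c[of s] d[of s] s by (intro has_vector_derivative_diff) (auto simp: at)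
    have "((\<lambda>s. (c s - d s) \<bullet> (c s - d s)) has_real_derivative (?e \<bullet> ?w + ?w \<bullet> ?e)) (at s)"
      using bounded_bilinear.has_vector_derivative[OF bounded_bilinear_inner e e]
      by (simp add: has_real_derivative_iff_has_vector_derivative)
    then have "(u has_real_derivative (?e \<bullet> ?w + ?w \<bullet> ?e) * exp (- (2 * P * L) * s)
        + (?e \<bullet> ?e) * (exp (- (2 * P * L) * s) * (- (2 * P * L)))) (at s)"
      unfolding u_def by (auto intro!: derivative_eq_intros)
    moreover have "(?e \<bullet> ?w + ?w \<bullet> ?e) * exp (- (2 * P * L) * s)
        + (?e \<bullet> ?e) * (exp (- (2 * P * L) * s) * (- (2 * P * L))) \<le> 0"
    proof -
      have "?e \<bullet> ?w \<le> norm ?e * norm ?w" by (rule norm_cauchy_schwarz)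
      also have "norm ?w = \<bar>\<phi> s\<bar> * norm (v (c s) - v (d s))"
        by (simp flip: scaleR_diff_right)
      also have "norm ?e * (\<bar>\<phi> s\<bar> * norm (v (c s) - v (d s))) \<le> norm ?e * (P * (L * norm ?e))"
        using s P R[of s] by (intro mult_left_mono mult_mono lip) auto
      also have "\<dots> = P * L * (?e \<bullet> ?e)" by (simp add: dot_square_norm power2_eq_square)
      finally have "(?e \<bullet> ?w + ?w \<bullet> ?e - 2 * P * L * (?e \<bullet> ?e)) * exp (- (2 * P * L) * s) \<le> 0"
        by (intro mult_nonpos_nonneg) (auto simp: inner_commute)
      then show ?thesis by (simp add: algebra_simps)
    qed
    ultimately show "\<exists>y. (u has_real_derivative y) (at s) \<and> y \<le> 0" by blast
  qed simp
  then have "u 1 \<le> 0" by (simp add: u_def init)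
  then have "(c 1 - d 1) \<bullet> (c 1 - d 1) \<le> 0" by (simp add: u_def mult_le_0_iff)
  then show ?thesis by (metis inner_gt_zero_iff linorder_not_less right_minus_eq)
qed

lemma real_polynomial_C1:
  assumes "real_polynomial_function f"
  shows "\<exists>f'. (\<forall>p. (f has_derivative f' p) (at p)) \<and> (\<forall>w. continuous_on UNIV (\<lambda>p. f' p w))"
  using assms
proof (induction rule: real_polynomial_function.induct)
  case (linear f)
  then show ?case
    by (intro exI[of _ "\<lambda>p. f"]) (auto intro: bounded_linear_imp_has_derivative continuous_intros)
next
  case (const c)
  show ?case by (intro exI[of _ "\<lambda>p w. 0"]) (auto intro: continuous_intros)
next
  case (add f g)
  then obtain f' g' where "\<And>p. (f has_derivative f' p) (at p)" "\<And>w. continuous_on UNIV (\<lambda>p. f' p w)"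
      "\<And>p. (g has_derivative g' p) (at p)" "\<And>w. continuous_on UNIV (\<lambda>p. g' p w)" by blast
  then show ?case
    by (intro exI[of _ "\<lambda>p w. f' p w + g' p w"]) (auto intro!: has_derivative_add continuous_intros)
next
  case (mult f g)
  then obtain f' g' where d: "\<And>p. (f has_derivative f' p) (at p)" "\<And>w. continuous_on UNIV (\<lambda>p. f' p w)"
      "\<And>p. (g has_derivative g' p) (at p)" "\<And>w. continuous_on UNIV (\<lambda>p. g' p w)" by blast
  have "continuous_on UNIV f" "continuous_on UNIV g"
    using mult.hyps continuous_real_polymonial_function by (auto simp: continuous_on_eq_continuous_at)
  with d show ?case
    by (intro exI[of _ "\<lambda>p w. f p * g' p w + f' p w * g p"]) (auto intro!: has_derivative_mult continuous_intros)
qed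

text \<open>
  For the derivative \<open>D\<close> of a real function this is its derivative by \<open>C\<close>; the derivative by \<open>B\<close>
  is the complex conjugate.
\<close>
definition half_grad :: "('k::finite pspace \<Rightarrow> real) \<Rightarrow> complex" where
  "half_grad D = Complex (D (0, 1)) (- D (0, \<i>)) / 2"

lemma frechet_cplx:
  assumes "(f has_derivative D) (at p)"
  shows "frechet_derivative (cplx f) (at p) = (\<lambda>w. of_real (D w))"
proof -
  have "(cplx f has_derivative (\<lambda>w. of_real (D w))) (at p)"
    unfolding cplx_def by (rule has_derivative_of_real[OF assms])
  then show ?thesis by (rule frechet_derivative_at[symmetric])
qed

lemma d_cplx:
  assumes "(f has_derivative D) (at p)"
  shows "d_C (cplx f) p = half_grad D" "d_B (cplx f) p = cnj (half_grad D)"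
    "d_A \<mu> (cplx f) p = of_real (D (axis \<mu> 1, 0))"
  unfolding d_C_def d_B_def d_A_def frechet_cplx[OF assms] half_grad_def
  by (simp_all add: complex_eq_iff)

lemma d_coord:
  "d_C (coord_A \<mu>) p = 0" "d_B (coord_A \<mu>) p = 0" "d_A \<nu> (coord_A \<mu>) p = (if \<nu> = \<mu> then 1 else 0)"
  "d_C snd p = 1" "d_B snd p = 0" "d_A \<nu> snd p = 0"
  by (simp_all add: d_C_def d_B_def d_A_def frechet_cplx_A frechet_C axis_def)

lemma sum_axis:
  fixes D :: "'k::finite pspace \<Rightarrow> real"
  assumes "linear D"
  shows "(\<Sum>\<mu>\<in>UNIV. x $ \<mu> * D (axis \<mu> 1, 0)) = D (x, 0)"
proof -
  have "(x, 0 :: complex) = (\<Sum>\<mu>\<in>UNIV. x $ \<mu> *\<^sub>R (axis \<mu> 1, 0))"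
    by (simp add: prod_eq_iff fst_sum snd_sum vec_eq_iff axis_def if_distrib cong: if_cong)
  then have "D (x, 0) = D (\<Sum>\<mu>\<in>UNIV. x $ \<mu> *\<^sub>R (axis \<mu> 1, 0))" by (rule arg_cong)
  also have "\<dots> = (\<Sum>\<mu>\<in>UNIV. x $ \<mu> * D (axis \<mu> 1, 0))"
    by (simp only: linear_sum[OF assms] linear_scale[OF assms] real_scaleR_def)
  finally show ?thesis ..
qed

lemma ham_field_eq:
  assumes f: "(f has_derivative D) (at (A, C))"
  shows "ham_field v \<rho> f (A, C) = ((- 2 * Im (C * half_grad D)) *\<^sub>R v A,
      - \<i> * of_real (lie_deriv v \<rho> A) * cnj (half_grad D) - \<i> * C * of_real (D (v A, 0)))"
proof -
  have lin: "linear D" using f by (rule has_derivative_linear)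
  have "poisson v \<rho> (cplx f) (coord_A \<mu>) (A, C) = of_real (- 2 * Im (C * half_grad D) * v A $ \<mu>)" for \<mu>
    unfolding poisson_def d_cplx[OF f] d_coord
    by (simp add: if_distrib if_distribR cong: if_cong) (simp add: complex_eq_iff algebra_simps)
  moreover have "poisson v \<rho> (cplx f) snd (A, C)
      = - \<i> * of_real (lie_deriv v \<rho> A) * cnj (half_grad D) - \<i> * C * of_real (D (v A, 0))"
  proof -
    have "(\<Sum>\<mu>\<in>UNIV. \<i> * complex_of_real (v A $ \<mu>) * C * - of_real (D (axis \<mu> 1, 0)))
        = - \<i> * C * of_real (\<Sum>\<mu>\<in>UNIV. v A $ \<mu> * D (axis \<mu> 1, 0))"
      by (simp add: sum_distrib_left sum_negf mult_ac)
    then show ?thesis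
      unfolding poisson_def d_cplx[OF f] d_coord sum_axis[OF lin] by simp
  qed
  ultimately show ?thesis by (simp add: ham_field_def prod_eq_iff vec_eq_iff)
qed

lemma poisson_eq:
  assumes f: "(f has_derivative D) (at (A, C))" and g: "(g has_derivative E) (at (A, C))"
  shows "poisson v \<rho> (cplx f) (cplx g) (A, C) = of_real (
      - 2 * lie_deriv v \<rho> A * Im (half_grad D * cnj (half_grad E))
      - 2 * Im (C * (half_grad D * of_real (E (v A, 0)) - of_real (D (v A, 0)) * half_grad E)))"
proof -
  have lin: "linear D" "linear E" using f g by (auto intro: has_derivative_linear)
  have s: "(\<Sum>\<mu>\<in>UNIV. x * complex_of_real (v A $ \<mu>) * y * (b * of_real (E (axis \<mu> 1, 0)) - of_real (D (axis \<mu> 1, 0)) * c))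
      = x * y * (b * of_real (E (v A, 0)) - of_real (D (v A, 0)) * c)" for x y b c
    unfolding sum_axis[OF lin(1), of "v A", symmetric] sum_axis[OF lin(2), of "v A", symmetric]
    by (simp add: sum_distrib_left sum_distrib_right sum_subtractf algebra_simps)
  show ?thesis
    unfolding poisson_def d_cplx[OF f] d_cplx[OF g] fst_conv snd_conv s
    by (simp add: complex_eq_iff algebra_simps)
qed

text \<open>
  The bracket depends on the two functions only through their Hamiltonian fields. With
  \<open>\<eta> = C \<partial>f/\<partial>C\<close> the component along \<open>v\<close> is \<open>-2 Im \<eta>\<close> and \<open>Im(w/C)\<close> is
  \<open>-\<lambda> Re \<eta>/|C|\<^sup>2\<close> minus the derivative of \<open>f\<close> along \<open>v\<close>; eliminating the differentials from
  the bracket leaves the formula below.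
\<close>
lemma poisson_of_ham_fields:
  assumes f: "(f has_derivative D) (at (A, C))" and g: "(g has_derivative E) (at (A, C))"
    and C: "C \<noteq> 0" and v: "v A \<noteq> 0"
    and hf: "ham_field v \<rho> f (A, C) = (s *\<^sub>R v A, w)" and hg: "ham_field v \<rho> g (A, C) = (s' *\<^sub>R v A, w')"
  shows "poisson v \<rho> (cplx f) (cplx g) (A, C) = of_real (s' * Im (w / C) - s * Im (w' / C))"
proof -
  define \<beta> \<beta>' l a a' where "\<beta> = half_grad D" and "\<beta>' = half_grad E" and "l = lie_deriv v \<rho> A"
    and "a = D (v A, 0)" and "a' = E (v A, 0)"
  have s: "s = - 2 * Im (C * \<beta>)" "s' = - 2 * Im (C * \<beta>')"
    using hf hg v unfolding ham_field_eq[OF f] ham_field_eq[OF g] \<beta>_def \<beta>'_def by auto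
  have w: "w = - \<i> * of_real l * cnj \<beta> - \<i> * C * of_real a" "w' = - \<i> * of_real l * cnj \<beta>' - \<i> * C * of_real a'"
    using hf hg unfolding ham_field_eq[OF f] ham_field_eq[OF g] \<beta>_def \<beta>'_def l_def a_def a'_def by auto
  define N where "N = (Re C)\<^sup>2 + (Im C)\<^sup>2"
  have N: "N \<noteq> 0" using C by (simp add: N_def complex_eq_iff sum_power2_eq_zero_iff)
  have im: "Im ((- \<i> * of_real l * cnj b - \<i> * C * of_real x) / C) = - l * Re (C * b) / N - x" for b x
  proof -
    have "(- \<i> * of_real l * cnj b - \<i> * C * of_real x) / C = - \<i> * of_real l * (cnj b / C) - \<i> * of_real x"
      using C by (simp add: diff_divide_distrib)
    moreover have "Re (cnj b / C) = Re (C * b) / N"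
      by (simp add: Re_divide N_def algebra_simps)
    moreover have "Im (- \<i> * of_real l * z - \<i> * of_real x) = - l * Re z - x" for z by simp
    ultimately show ?thesis by (simp only:) (simp add: mult.commute)
  qed
  have "(Im (C * \<beta>) * Re (C * \<beta>') - Im (C * \<beta>') * Re (C * \<beta>)) = N * Im (\<beta> * cnj \<beta>')"
    by (simp add: N_def algebra_simps power2_eq_square)
  then have 1: "Im (\<beta> * cnj \<beta>') = (Im (C * \<beta>) * Re (C * \<beta>') - Im (C * \<beta>') * Re (C * \<beta>)) / N"
    using N by simp
  have 2: "Im (C * (\<beta> * of_real a' - of_real a * \<beta>')) = Im (C * \<beta>) * a' - a * Im (C * \<beta>')"
    by (simp add: algebra_simps)
  have 3: "- 2 * l * ((e * r' - e' * r) / N) - 2 * (e * a' - a * e')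
      = - 2 * e' * (- l * r / N - a) - - 2 * e * (- l * r' / N - a')" for e r e' r'
    using N by (simp add: field_simps)
  have "- 2 * l * Im (\<beta> * cnj \<beta>') - 2 * Im (C * (\<beta> * of_real a' - of_real a * \<beta>'))
      = s' * Im (w / C) - s * Im (w' / C)"
    unfolding 1 2 w im s by (rule 3)
  then show ?thesis unfolding poisson_eq[OF f g] \<beta>_def \<beta>'_def l_def a_def a'_def by simp
qed

text \<open>
  The side condition says that \<open>(s v, w)\<close> is tangent to the leaf: it is the derivative of
  \<open>BC = \<rho>(A) - K\<close>. A real-linear \<open>f\<close> suffices; its \<open>C\<close>-derivative \<open>\<beta>\<close> is fixed by
  \<open>-2 Im(C\<beta>) = s\<close>, with \<open>Re(C\<beta>) = 0\<close>, and its derivative along \<open>v\<close> by \<open>Im(w/C)\<close>.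
\<close>
lemma ham_field_realizes:
  fixes v :: "real^'k::finite \<Rightarrow> real^'k"
  assumes C: "C \<noteq> 0" and v: "v A \<noteq> 0"
    and tangent: "Re (w / C) = s * lie_deriv v \<rho> A / (2 * (cmod C)\<^sup>2)"
  shows "\<exists>f. real_polynomial_function f \<and> ham_field v \<rho> f (A, C) = (s *\<^sub>R v A, w)"
proof -
  define \<beta> where "\<beta> = - \<i> * of_real (s / 2) / C"
  define \<alpha> where "\<alpha> = (- Im (w / C) / (v A \<bullet> v A)) *\<^sub>R v A"
  define f where "f p = \<alpha> \<bullet> fst p + 2 * Re (\<beta> * snd p)" for p :: "'k pspace"
  have "linear f" by (rule linearI) (simp_all add: f_def inner_add_right algebra_simps)
  then have bl: "bounded_linear f" by (simp add: linear_conv_bounded_linear)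
  have d: "(f has_derivative f) (at (A, C))" using bl by (rule bounded_linear_imp_has_derivative)
  have hg: "half_grad f = \<beta>" by (simp add: half_grad_def f_def complex_eq_iff)
  have fv: "f (v A, 0) = - Im (w / C)" using v by (simp add: f_def \<alpha>_def)
  have "C * \<beta> = - \<i> * of_real (s / 2)" using C by (simp add: \<beta>_def)
  then have 1: "- 2 * Im (C * half_grad f) = s" unfolding hg by simp
  have "cnj \<beta> = \<i> * of_real (s / 2) / cnj C" by (simp add: \<beta>_def)
  also have "\<dots> = \<i> * of_real (s / (2 * (cmod C)\<^sup>2)) * C"
    unfolding of_real_divide of_real_mult complex_norm_square using C by (simp add: field_simps)
  finally have cnj_beta: "cnj \<beta> = \<i> * of_real (s / (2 * (cmod C)\<^sup>2)) * C" .
  have "Re (w / C) = lie_deriv v \<rho> A * (s / (2 * (cmod C)\<^sup>2))" unfolding tangent by simp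
  then have "- \<i> * of_real (lie_deriv v \<rho> A) * cnj \<beta> = of_real (Re (w / C)) * C"
    unfolding cnj_beta by (simp only:) (simp add: complex_eq_iff del: of_real_divide)
  moreover have "- \<i> * C * of_real (- Im (w / C)) = \<i> * of_real (Im (w / C)) * C" by simp
  ultimately have "- \<i> * of_real (lie_deriv v \<rho> A) * cnj \<beta> - \<i> * C * of_real (- Im (w / C))
      = (of_real (Re (w / C)) + \<i> * of_real (Im (w / C))) * C"
    by (simp only: distrib_right) simp
  also have "\<dots> = w" using C by (simp flip: complex_eq)
  finally have "- \<i> * of_real (lie_deriv v \<rho> A) * cnj (half_grad f) - \<i> * C * of_real (f (v A, 0)) = w"
    unfolding hg fv .
  with 1 have "ham_field v \<rho> f (A, C) = (s *\<^sub>R v A, w)" unfolding ham_field_eq[OF d] by simp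
  moreover have "real_polynomial_function f" using bl by (rule real_polynomial_function.intros(1))
  ultimately show ?thesis by blast
qed

section \<open>The coordinate on the leaf and the classical form\<close>
context cylindrical_leaf
begin

lemma flow_deriv: "((\<lambda>t. \<gamma> t a) has_vector_derivative v (\<gamma> t a)) (at t)"
  and flow_0: "\<gamma> 0 a = a"
  and flow_add: "\<gamma> (s + t) a = \<gamma> s (\<gamma> t a)"
  using flow unfolding complete_flow_def by blast+

lemma flow_inj: "\<gamma> s a0 = \<gamma> t a0 \<longleftrightarrow> s = t"
proof
  assume eq: "\<gamma> s a0 = \<gamma> t a0"
  have "\<gamma> (s - t) a0 = \<gamma> (- t) (\<gamma> s a0)" using flow_add[of "- t" s a0] by simp
  also have "\<dots> = a0" unfolding eq using flow_add[of "- t" t a0] flow_0 by simp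
  finally show "s = t" using not_periodic[of "s - t"] by auto
qed simp

text \<open>
  A zero of \<open>v\<close> on the trajectory would make it constant, hence periodic.
\<close>
lemma v_orbit_nonzero: "v (\<gamma> t a0) \<noteq> 0"
proof
  assume z: "v (\<gamma> t a0) = 0"
  have "\<gamma> 1 (\<gamma> t a0) = (\<lambda>s. \<gamma> t a0) (1 :: real)"
    using v_C1
  proof (rule ode_unique[where \<phi> = "\<lambda>s. 1"])
    show "((\<lambda>s. \<gamma> s (\<gamma> t a0)) has_vector_derivative 1 *\<^sub>R v (\<gamma> s (\<gamma> t a0))) (at s within {0..1})" for s
      using has_vector_derivative_at_within[OF flow_deriv] by simp
  qed (auto simp: flow_0 z)
  then have "\<gamma> (1 + t) a0 = \<gamma> t a0" by (simp add: flow_add)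
  then show False by (simp add: flow_inj)
qed

text \<open>
  The projection of a Hamiltonian trajectory to the \<open>A\<close>-space solves \<open>A' = \<phi> v(A)\<close>, and so does
  the flow of \<open>v\<close> run for the time \<open>\<integral>\<phi>\<close>.
\<close>
lemma ham_step_flow:
  assumes "ham_step v \<rho> p q"
  shows "\<exists>t. fst q = \<gamma> t (fst p)"
proof -
  obtain f c where f: "real_polynomial_function f" and c01: "c 0 = p" "c 1 = q"
    and c: "\<And>s. s \<in> {0..1} \<Longrightarrow> (c has_vector_derivative ham_field v \<rho> f (c s)) (at s within {0..1})"
    using assms unfolding ham_step_def by blast
  obtain f' where f': "\<And>p. (f has_derivative f' p) (at p)" "\<And>w. continuous_on UNIV (\<lambda>p. f' p w)"
    using real_polynomial_C1[OF f] by blast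
  have cc: "continuous_on {0..1} c"
    using c by (meson continuous_on_eq_continuous_within has_vector_derivative_continuous)
  have cf: "continuous_on {0..1} (\<lambda>s. f' (c s) w)" for w
    by (rule continuous_on_compose2[OF f'(2) cc]) auto
  define \<phi> where "\<phi> s = - 2 * Im (snd (c s) * half_grad (f' (c s)))" for s
  have \<phi>: "continuous_on {0..1} \<phi>"
  proof -
    have "half_grad D = (of_real (D (0, 1)) - \<i> * of_real (D (0, \<i>))) / 2" for D :: "'k pspace \<Rightarrow> real"
      by (simp add: half_grad_def complex_eq_iff)
    then show ?thesis unfolding \<phi>_def by (simp only:) (intro continuous_intros cc cf; simp)
  qed
  define \<tau> where "\<tau> s = integral {0..s} \<phi>" for s
  have \<tau>: "(\<tau> has_vector_derivative \<phi> s) (at s within {0..1})" if "s \<in> {0..1}" for s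
    unfolding \<tau>_def by (rule integral_has_vector_derivative[OF \<phi> that])
  have "fst (c 1) = \<gamma> (\<tau> 1) (fst (c 0))"
  proof (rule ode_unique[OF v_C1 \<phi>, where c = "\<lambda>s. fst (c s)" and d = "\<lambda>s. \<gamma> (\<tau> s) (fst (c 0))"])
    fix s :: real assume s: "s \<in> {0..1}"
    have "fst (ham_field v \<rho> f (c s)) = \<phi> s *\<^sub>R v (fst (c s))"
      using ham_field_eq[of f "f' (c s)" "fst (c s)" "snd (c s)"] f'(1)[of "c s"] by (simp add: \<phi>_def)
    then show "((\<lambda>s. fst (c s)) has_vector_derivative \<phi> s *\<^sub>R v (fst (c s))) (at s within {0..1})"
      using bounded_linear.has_vector_derivative[OF bounded_linear_fst c[OF s]] by simp
    show "((\<lambda>s. \<gamma> (\<tau> s) (fst (c 0))) has_vector_derivative \<phi> s *\<^sub>R v (\<gamma> (\<tau> s) (fst (c 0)))) (at s within {0..1})"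
      using vector_diff_chain_within[OF \<tau>[OF s] has_vector_derivative_at_within[OF flow_deriv], of "fst (c 0)"]
      by (simp add: o_def)
  next
    show "fst (c 0) = \<gamma> (\<tau> 0) (fst (c 0))" by (simp add: \<tau>_def flow_0)
  qed
  then show ?thesis using c01 by auto
qed

lemma ham_steps_flow:
  assumes "(ham_step v \<rho>)\<^sup>*\<^sup>* p q"
  shows "\<exists>t. fst q = \<gamma> t (fst p)"
  using assms
proof (induction rule: rtranclp_induct)
  case base
  show ?case by (intro exI[of _ 0]) (simp add: flow_0)
next
  case (step y z)
  then show ?case using ham_step_flow[OF step.hyps(2)] by (metis flow_add)
qed

lemma poly_orbit_deriv:
  assumes "real_polynomial_function f"
  shows "((\<lambda>t. f (\<gamma> t a0)) has_real_derivative lie_deriv v f (\<gamma> t a0)) (at t)"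
proof -
  obtain f' where f': "\<And>p. (f has_derivative f' p) (at p)" using real_polynomial_C1[OF assms] by blast
  have "((\<lambda>t. f (\<gamma> t a0)) has_derivative (\<lambda>x. f' (\<gamma> t a0) (x *\<^sub>R v (\<gamma> t a0)))) (at t)"
    using has_derivative_compose[OF flow_deriv[unfolded has_vector_derivative_def] f'] .
  moreover have "f' (\<gamma> t a0) (x *\<^sub>R v (\<gamma> t a0)) = lie_deriv v f (\<gamma> t a0) * x" for x
    using linear_scale[OF has_derivative_linear[OF f']] frechet_derivative_at[OF f']
    by (simp add: lie_deriv_def)
  ultimately show ?thesis by (simp add: has_field_derivative_def)
qed

lemma kappa_orbit:
  assumes "j \<in> {1..<CARD('k)}"
  shows "\<kappa> j (\<gamma> t a0) = \<kappa> j a0"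
proof -
  have "\<forall>t. ((\<lambda>t. \<kappa> j (\<gamma> t a0)) has_real_derivative 0) (at t)"
    using poly_orbit_deriv[OF kappa_poly[OF assms]] v_annuls[OF assms] by simp
  then have "\<kappa> j (\<gamma> t a0) = \<kappa> j (\<gamma> 0 a0)" by (rule DERIV_isconst_all)
  then show ?thesis by (simp add: flow_0)
qed

text \<open>
  The equations of \<open>X\<close> only confine \<open>A\<close> to a common level set of the \<open>\<kappa>\<^sub>j\<close>, which may have several
  components; that \<open>X\<close> is a single leaf restricts \<open>A\<close> to one trajectory.
\<close>
lemma leaf_iff: "(A, C) \<in> X \<longleftrightarrow> (\<exists>t. A = \<gamma> t a0 \<and> cmod C = cmod (M A))"
proof -
  have norm: "of_real (\<rho> A) - cnj C * C = complex_of_real K \<longleftrightarrow> \<rho> A - K = (cmod C)\<^sup>2" for A C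
  proof -
    have "cnj C * C = of_real ((cmod C)\<^sup>2)" by (simp only: complex_norm_square mult.commute)
    then have "of_real (\<rho> A) - cnj C * C = complex_of_real K
        \<longleftrightarrow> complex_of_real (\<rho> A - (cmod C)\<^sup>2) = of_real K" by simp
    then show ?thesis unfolding of_real_eq_iff by linarith
  qed
  have orbit: "\<rho> (\<gamma> t a0) - K = (cmod (M (\<gamma> t a0)))\<^sup>2" for t
    using M_factor[of "\<gamma> t a0"] g_orbit(1)[of t] by simp
  have base: "(a0, M a0) \<in> X" using orbit[of 0] by (simp add: X_def norm flow_0)
  obtain p where p: "X = {q. (ham_step v \<rho>)\<^sup>*\<^sup>* p q}" using X_leaf unfolding symplectic_leaf_def by blast
  obtain t0 where t0: "a0 = \<gamma> t0 (fst p)" using ham_steps_flow[of p "(a0, M a0)"] base p by auto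
  show ?thesis
  proof
    assume X: "(A, C) \<in> X"
    then obtain t where "A = \<gamma> t (fst p)" using ham_steps_flow[of p "(A, C)"] p by auto
    then have A: "A = \<gamma> (t - t0) a0" by (simp add: t0 flow_add[symmetric])
    have "\<rho> A - K = (cmod C)\<^sup>2" using X by (simp add: X_def norm)
    then show "\<exists>t. A = \<gamma> t a0 \<and> cmod C = cmod (M A)" using A orbit[of "t - t0"] by auto
  next
    assume "\<exists>t. A = \<gamma> t a0 \<and> cmod C = cmod (M A)"
    then show "(A, C) \<in> X" using orbit kappa_orbit by (auto simp: X_def norm)
  qed
qed

lemma M_orbit_nonzero: "M (\<gamma> t a0) \<noteq> 0"
  using K_less[of "\<gamma> t a0"] kappa_orbit M_factor[of "\<gamma> t a0"] g_orbit(1)[of t] by auto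

lemma leaf_point_eq:
  "leaf_point X \<gamma> a0 M z = (\<gamma> (Re z) a0, cis (Im z) * cnj (M (\<gamma> (Re z) a0)))"
  unfolding leaf_point_def
proof (rule the_equality)
  have time: "leaf_time \<gamma> a0 (\<gamma> t a0) = t" for t
    unfolding leaf_time_def by (rule the_equality) (auto simp: flow_inj)
  let ?p = "(\<gamma> (Re z) a0, cis (Im z) * cnj (M (\<gamma> (Re z) a0)))"
  show "?p \<in> X \<and> exp z = leaf_exp \<gamma> a0 M ?p"
    using M_orbit_nonzero[of "Re z"]
    by (auto simp: leaf_iff leaf_exp_def time norm_mult exp_eq_polar exp_of_real mult.commute)
  fix p assume p: "p \<in> X \<and> exp z = leaf_exp \<gamma> a0 M p"
  obtain A C where pe: "p = (A, C)" by (cases p)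
  obtain t where t: "A = \<gamma> t a0" "cmod C = cmod (M A)" using p leaf_iff by (auto simp: pe)
  have ez: "exp z = C * exp (of_real t) / cnj (M A)" using p by (simp add: pe leaf_exp_def t(1) time)
  have "cmod (exp z) = exp t"
    unfolding ez using t M_orbit_nonzero[of t] by (simp add: norm_mult norm_divide)
  then have "Re z = t" by simp
  then have "exp z = cis (Im z) * exp (of_real t)" by (simp add: exp_eq_polar exp_of_real mult.commute)
  with ez have "(C / cnj (M A)) * exp (of_real t) = cis (Im z) * exp (of_real t)" by simp
  then have "C / cnj (M A) = cis (Im z)" by (subst (asm) mult_right_cancel) simp_all
  then have "C = cis (Im z) * cnj (M A)" using M_orbit_nonzero[of t] t(1) by (simp add: field_simps)
  with \<open>Re z = t\<close> show "p = ?p" by (simp add: pe t(1))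
qed

text \<open>
  The number \<open>m'\<close> is the derivative of \<open>M\<close> along the trajectory. Its relation to \<open>\<lambda> = v(\<rho>)\<close>
  comes from differentiating \<open>|M|\<^sup>2 = \<rho> - K\<close>, and provides the tangency needed to
  realize the coordinate fields by Hamiltonians.
\<close>
lemma leaf_point_deriv:
  obtains m' where
    "\<And>a. frechet_derivative (leaf_point X \<gamma> a0 M) (at z) a
       = (Re a *\<^sub>R v (\<gamma> (Re z) a0), cis (Im z) * (Im a * \<i> * cnj (M (\<gamma> (Re z) a0)) + Re a * cnj m'))"
    "lie_deriv v \<rho> (\<gamma> (Re z) a0) = 2 * Re (cnj (M (\<gamma> (Re z) a0)) * m')"
proof -
  let ?A = "\<gamma> (Re z) a0"
  obtain M' where M': "(M has_derivative M') (at ?A)"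
    using differentiable_at_polynomial_function[OF M_poly] unfolding differentiable_def by blast
  define m' where "m' = M' (v ?A)"
  have dm: "((\<lambda>t. M (\<gamma> t a0)) has_vector_derivative m') (at (Re z))"
    using has_derivative_compose[OF flow_deriv[unfolded has_vector_derivative_def] M']
    by (simp add: has_vector_derivative_def m'_def linear_scale[OF has_derivative_linear[OF M']])
  have dRe: "(Re has_derivative Re) (at z)" and dIm: "(Im has_derivative Im) (at z)"
    by (intro bounded_linear_imp_has_derivative bounded_linear_Re bounded_linear_Im)+
  have dA: "((\<lambda>z. \<gamma> (Re z) a0) has_derivative (\<lambda>a. Re a *\<^sub>R v ?A)) (at z)"
    using has_derivative_compose[OF dRe flow_deriv[unfolded has_vector_derivative_def]] .
  have dM: "((\<lambda>z. cnj (M (\<gamma> (Re z) a0))) has_derivative (\<lambda>a. Re a * cnj m')) (at z)"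
    using has_derivative_cnj[OF has_derivative_compose[OF dRe dm[unfolded has_vector_derivative_def]]]
    by (simp add: scaleR_conv_of_real)
  have dcis: "((\<lambda>z. cis (Im z)) has_derivative (\<lambda>a. Im a * \<i> * cis (Im z))) (at z)"
  proof -
    show ?thesis using has_derivative_cis[OF dIm] by (simp add: scaleR_conv_of_real mult_ac)
  qed
  have "(leaf_point X \<gamma> a0 M has_derivative (\<lambda>a. (Re a *\<^sub>R v ?A,
      cis (Im z) * (Im a * \<i> * cnj (M ?A) + Re a * cnj m')))) (at z)"
    unfolding leaf_point_eq[abs_def]
    by (rule has_derivative_eq_rhs[OF has_derivative_Pair[OF dA has_derivative_mult[OF dcis dM]]])
      (simp add: fun_eq_iff algebra_simps)
  from frechet_derivative_at[OF this, symmetric]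
  have 1: "frechet_derivative (leaf_point X \<gamma> a0 M) (at z) a
       = (Re a *\<^sub>R v ?A, cis (Im z) * (Im a * \<i> * cnj (M ?A) + Re a * cnj m'))" for a by simp
  have "((\<lambda>t. M (\<gamma> t a0) \<bullet> M (\<gamma> t a0)) has_vector_derivative (M ?A \<bullet> m' + m' \<bullet> M ?A)) (at (Re z))"
    by (rule bounded_bilinear.has_vector_derivative[OF bounded_bilinear_inner dm dm])
  moreover have "M (\<gamma> t a0) \<bullet> M (\<gamma> t a0) = \<rho> (\<gamma> t a0) - K" for t
    using M_factor[of "\<gamma> t a0"] g_orbit(1)[of t] by (simp add: dot_square_norm)
  ultimately have "((\<lambda>t. \<rho> (\<gamma> t a0) - K) has_real_derivative (M ?A \<bullet> m' + m' \<bullet> M ?A)) (at (Re z))"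
    by (simp add: has_real_derivative_iff_has_vector_derivative)
  moreover have "((\<lambda>t. \<rho> (\<gamma> t a0) - K) has_real_derivative lie_deriv v \<rho> ?A) (at (Re z))"
    using DERIV_diff[OF poly_orbit_deriv[OF rho_poly] DERIV_const] by simp
  ultimately have "lie_deriv v \<rho> ?A = M ?A \<bullet> m' + m' \<bullet> M ?A" by (rule DERIV_unique[rotated])
  then have 2: "lie_deriv v \<rho> ?A = 2 * Re (cnj (M ?A) * m')" by (simp add: inner_complex_def)
  show thesis using 1 2 by (rule that)
qed

lemma classical_form_eq:
  "classical_form v \<rho> \<gamma> a0 M X = (\<lambda>z a b. \<i> / 2 * dzbar_dz a b)"
proof (intro ext)
  fix z a b
  let ?A = "\<gamma> (Re z) a0"
  define C where "C = cis (Im z) * cnj (M ?A)"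
  obtain m' where d: "\<And>a. frechet_derivative (leaf_point X \<gamma> a0 M) (at z) a
       = (Re a *\<^sub>R v ?A, cis (Im z) * (Im a * \<i> * cnj (M ?A) + Re a * cnj m'))"
    and lie: "lie_deriv v \<rho> ?A = 2 * Re (cnj (M ?A) * m')"
    by (rule leaf_point_deriv[where z = z]) (rule that, assumption+)
  define w where "w a = cis (Im z) * (Im a * \<i> * cnj (M ?A) + Re a * cnj m')" for a
  have C: "C \<noteq> 0" using M_orbit_nonzero by (simp add: C_def)
  have v: "v ?A \<noteq> 0" by (rule v_orbit_nonzero)
  have wC: "w a / C = Im a * \<i> + Re a * cnj (m' / M ?A)" for a
    using M_orbit_nonzero[of "Re z"] by (simp add: w_def C_def field_simps)
  have tangent: "Re (w a / C) = Re a * lie_deriv v \<rho> ?A / (2 * (cmod C)\<^sup>2)" for a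
  proof -
    have "m' / M ?A = cnj (M ?A) * m' / of_real ((cmod (M ?A))\<^sup>2)"
      unfolding complex_norm_square using M_orbit_nonzero[of "Re z"] by (simp add: field_simps)
    then have m: "Re (m' / M ?A) = Re (cnj (M ?A) * m') / (cmod (M ?A))\<^sup>2"
      by (simp only: Re_divide_of_real)
    have re: "Re (of_real x * \<i> + of_real y * cnj u) = y * Re u" for x y u by simp
    have cC: "cmod C = cmod (M ?A)" by (simp add: C_def norm_mult)
    have "x * (r / n) = x * (2 * r) / (2 * n)" for x r n :: real by simp
    then show ?thesis unfolding wC re m lie cC .
  qed
  have form: "poisson v \<rho> (cplx f) (cplx g) (?A, C) = of_real (- Im (cnj a * b))"
    if f: "real_polynomial_function f" and g: "real_polynomial_function g"
      and hf: "ham_field v \<rho> f (?A, C) = (Re a *\<^sub>R v ?A, w a)"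
      and hg: "ham_field v \<rho> g (?A, C) = (Re b *\<^sub>R v ?A, w b)" for f g
  proof -
    obtain D E where "(f has_derivative D) (at (?A, C))" "(g has_derivative E) (at (?A, C))"
      using real_polynomial_C1[OF f] real_polynomial_C1[OF g] by blast
    from poisson_of_ham_fields[OF this C v hf hg]
    have "poisson v \<rho> (cplx f) (cplx g) (?A, C) = of_real (Re b * Im (w a / C) - Re a * Im (w b / C))" .
    also have "Im (of_real x * \<i> + of_real y * cnj u) = x - y * Im u" for x y u by simp
    then have "Re b * Im (w a / C) - Re a * Im (w b / C) = - Im (cnj a * b)"
      unfolding wC by (simp only:) (simp add: algebra_simps)
    finally show ?thesis .
  qed
  have "leaf_symplectic_form v \<rho> (?A, C) (Re a *\<^sub>R v ?A, w a) (Re b *\<^sub>R v ?A, w b) = - Im (cnj a * b)"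
    unfolding leaf_symplectic_form_def
  proof (rule the_equality)
    obtain f g where "real_polynomial_function f" "ham_field v \<rho> f (?A, C) = (Re a *\<^sub>R v ?A, w a)"
        "real_polynomial_function g" "ham_field v \<rho> g (?A, C) = (Re b *\<^sub>R v ?A, w b)"
      using ham_field_realizes[OF C v tangent] by meson
    with form show "\<exists>f g. real_polynomial_function f \<and> real_polynomial_function g \<and>
        ham_field v \<rho> f (?A, C) = (Re a *\<^sub>R v ?A, w a) \<and> ham_field v \<rho> g (?A, C) = (Re b *\<^sub>R v ?A, w b) \<and>
        poisson v \<rho> (cplx f) (cplx g) (?A, C) = of_real (- Im (cnj a * b))" by blast
  next
    fix r
    assume "\<exists>f g. real_polynomial_function f \<and> real_polynomial_function g \<and>
        ham_field v \<rho> f (?A, C) = (Re a *\<^sub>R v ?A, w a) \<and> ham_field v \<rho> g (?A, C) = (Re b *\<^sub>R v ?A, w b) \<and>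
        poisson v \<rho> (cplx f) (cplx g) (?A, C) = of_real r"
    then have "complex_of_real r = of_real (- Im (cnj a * b))" using form by force
    then show "r = - Im (cnj a * b)" by (simp only: of_real_eq_iff)
  qed
  then have "classical_form v \<rho> \<gamma> a0 M X z a b = of_real (- Im (cnj a * b))"
    unfolding classical_form_def d leaf_point_eq w_def C_def by simp
  also have "\<dots> = \<i> / 2 * dzbar_dz a b"
    by (simp add: dzbar_dz_def complex_eq_iff)
  finally show "classical_form v \<rho> \<gamma> a0 M X z a b = \<i> / 2 * dzbar_dz a b" .
qed

end

section \<open>Uniqueness of Fourier coefficients\<close>
lemma real_linear_complex:
  assumes "bounded_linear (f :: complex \<Rightarrow> real)"
  shows "f z = f 1 * Re z + f \<i> * Im z"
proof -
  interpret bounded_linear f by fact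
  have "f z = f (Re z *\<^sub>R 1 + Im z *\<^sub>R \<i>)"
    by (rule arg_cong[of _ _ f]) (simp add: complex_eq_iff)
  then show ?thesis by (simp only: add scaleR) (simp add: mult.commute)
qed

definition vanishing_fourier :: "(real \<Rightarrow> complex) \<Rightarrow> bool" where
  "vanishing_fourier f \<longleftrightarrow> continuous_on {0..1} f \<and>
     (\<forall>n::int. integral {0..1} (\<lambda>x. f x * cis (2 * pi * of_int n * x)) = 0)"

lemma vanishing_fourier_integrable:
  "vanishing_fourier f \<Longrightarrow> (\<lambda>x. f x * cis (2 * pi * of_int n * x)) integrable_on {0..1}"
  unfolding vanishing_fourier_def
  by (intro integrable_continuous_interval continuous_intros) auto

lemma vanishing_fourier_add: "vanishing_fourier f \<Longrightarrow> vanishing_fourier g \<Longrightarrow> vanishing_fourier (\<lambda>x. f x + g x)"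
  using vanishing_fourier_integrable[of f] vanishing_fourier_integrable[of g]
  by (auto simp: vanishing_fourier_def distrib_right integral_add intro!: continuous_intros)

lemma vanishing_fourier_cmult: "vanishing_fourier f \<Longrightarrow> vanishing_fourier (\<lambda>x. f x * c)"
proof -
  assume f: "vanishing_fourier f"
  have "integral {0..1} (\<lambda>x. f x * c * cis (2 * pi * of_int n * x)) = 0" for n :: int
  proof -
    have "integral {0..1} (\<lambda>x. f x * c * cis (2 * pi * of_int n * x))
        = integral {0..1} (\<lambda>x. f x * cis (2 * pi * of_int n * x) * c)"
      by (intro integral_cong) simp
    then show ?thesis using f by (simp add: vanishing_fourier_def)
  qed
  then show ?thesis using f by (auto simp: vanishing_fourier_def intro!: continuous_intros)
qed

lemma vanishing_fourier_shift: "vanishing_fourier f \<Longrightarrow> vanishing_fourier (\<lambda>x. f x * cis (2 * pi * of_int m * x))"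
proof -
  assume f: "vanishing_fourier f"
  have "integral {0..1} (\<lambda>x. f x * cis (2 * pi * of_int m * x) * cis (2 * pi * of_int n * x)) = 0"
    for n :: int
  proof -
    have "integral {0..1} (\<lambda>x. f x * cis (2 * pi * of_int m * x) * cis (2 * pi * of_int n * x))
        = integral {0..1} (\<lambda>x. f x * cis (2 * pi * of_int (m + n) * x))"
      by (intro integral_cong) (simp add: cis_mult distrib_left distrib_right mult.assoc)
    also have "\<dots> = 0" using f unfolding vanishing_fourier_def by blast
    finally show ?thesis .
  qed
  then show ?thesis using f by (auto simp: vanishing_fourier_def intro!: continuous_intros)
qed

text \<open>
  On the unit circle the coordinates are combinations of \<open>cis (\<plusminus>t)\<close>, which merely shift Fourier
  coefficients. Keeping \<open>f\<close> arbitrary in the induction handles products of polynomials without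
  expanding them into trigonometric sums.
\<close>
lemma vanishing_fourier_real_polynomial:
  assumes "real_polynomial_function p" "vanishing_fourier f"
  shows "vanishing_fourier (\<lambda>x. f x * of_real (p (cis (2 * pi * x))))"
  using assms
proof (induction arbitrary: f rule: real_polynomial_function.induct)
  case (linear l)
  define a b where "a = complex_of_real (l 1)" and "b = complex_of_real (l \<i>)"
  have *: "f x * of_real (l (cis (2 * pi * x)))
      = (f x * cis (2 * pi * of_int 1 * x)) * ((a - \<i> * b) / 2)
        + (f x * cis (2 * pi * of_int (-1) * x)) * ((a + \<i> * b) / 2)" for x
    unfolding a_def b_def real_linear_complex[OF linear(1), of "cis (2 * pi * x)"]
    by (simp add: complex_eq_iff field_simps)
  show ?case
    unfolding * by (intro vanishing_fourier_add vanishing_fourier_cmult vanishing_fourier_shift linear)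
next
  case (const c)
  then show ?case by (intro vanishing_fourier_cmult)
next
  case (add p q)
  show ?case
    using vanishing_fourier_add[OF add.IH(1)[OF add.prems] add.IH(2)[OF add.prems]]
    by (simp add: distrib_left)
next
  case (mult p q)
  show ?case
    using mult.IH(2)[OF mult.IH(1)[OF mult.prems]]
    by (simp add: mult.assoc)
qed

lemma vanishing_fourier_polynomial:
  assumes "polynomial_function p" "vanishing_fourier f"
  shows "vanishing_fourier (\<lambda>x. f x * p (cis (2 * pi * x)))"
proof -
  have r: "real_polynomial_function (\<lambda>z. Re (p z))" "real_polynomial_function (\<lambda>z. Im (p z))"
    using assms(1) bounded_linear_Re bounded_linear_Im unfolding polynomial_function_def o_def by blast+
  have *: "f x * p (cis (2 * pi * x)) = f x * of_real (Re (p (cis (2 * pi * x))))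
      + f x * of_real (Im (p (cis (2 * pi * x)))) * \<i>" for x
    by (metis complex_eq distrib_left mult.assoc mult.commute)
  show ?thesis unfolding *
    by (intro vanishing_fourier_add vanishing_fourier_cmult vanishing_fourier_real_polynomial r assms)
qed

text \<open>
  By Weierstrass approximation on the circle, the conjugate of \<open>f\<close> is a uniform limit of polynomials
  \<open>p\<close>, and \<open>f p\<close> has mean zero; hence so has \<open>|f|\<^sup>2\<close>.
\<close>
lemma vanishing_fourier_imp_zero:
  assumes f: "vanishing_fourier f" and ends: "f 0 = f 1" and x: "x \<in> {0..1}"
  shows "f x = 0"
proof -
  have cont: "continuous_on {0..1} f" using f by (simp add: vanishing_fourier_def)
  \<comment> \<open>The function on the circle from which \<open>f\<close> arises; continuity at \<open>1\<close> uses \<open>f 0 = f 1\<close>.\<close>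
  define d where "d = f \<circ> (\<lambda>z. Arg2pi z / (2 * pi))"
  have "homotopic_loops UNIV f f"
    using cont ends by (simp add: homotopic_loops_refl path_def pathstart_def pathfinish_def)
  then have "continuous_on (sphere 0 1) d"
    unfolding d_def using homotopic_loops_imp_homotopic_circlemaps homotopic_with_imp_continuous
    by blast
  then have contd: "continuous_on (sphere 0 1) (\<lambda>z. cnj (d z))"
    by (intro continuous_intros)
  have d: "d (cis (2 * pi * x)) = f x" if "x \<in> {0..1}" for x
  proof (cases "x = 1")
    case False
    have "Arg2pi (cis (2 * pi * x)) = 2 * pi * x"
      using that False by (intro Arg2pi_unique[of 1]) (auto simp: cis_conv_exp)
    then show ?thesis by (simp add: d_def)
  next
    case True
    have "Arg2pi 1 = 0" by (intro Arg2pi_unique[of 1]) auto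
    then show ?thesis using ends True by (simp add: d_def)
  qed
  define I where "I = integral {0..1} (\<lambda>x. (cmod (f x))\<^sup>2)"
  obtain B where B: "\<And>x. x \<in> {0..1} \<Longrightarrow> cmod (f x) \<le> B" "B > 0"
  proof -
    have "bounded (f ` {0..1})"
      using compact_continuous_image[OF cont] compact_imp_bounded by blast
    then obtain b where "b > 0" "\<forall>y\<in>f ` {0..1}. cmod y \<le> b" unfolding bounded_pos by blast
    then show ?thesis by (intro that[of b]) auto
  qed
  have I0: "I \<ge> 0" unfolding I_def by (rule integral_nonneg)
      (auto intro!: integrable_continuous_interval continuous_intros cont)
  have "I \<le> 0"
  proof (rule field_le_epsilon)
    fix e :: real assume e: "0 < e"
    obtain p where p: "polynomial_function p" "\<And>z. z \<in> sphere 0 1 \<Longrightarrow> cmod (cnj (d z) - p z) < e / B"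
      using Stone_Weierstrass_polynomial_function[OF compact_sphere contd, of "e / B"] e B(2) by auto
    have nf: "vanishing_fourier (\<lambda>x. f x * p (cis (2 * pi * x)))"
      by (rule vanishing_fourier_polynomial) (fact p f)+
    then have z: "integral {0..1} (\<lambda>x. f x * p (cis (2 * pi * x))) = 0"
        and c: "continuous_on {0..1} (\<lambda>x. f x * p (cis (2 * pi * x)))"
      unfolding vanishing_fourier_def by (auto dest!: spec[of _ 0])
    have "complex_of_real I = integral {0..1} (\<lambda>x. of_real ((cmod (f x))\<^sup>2))"
      unfolding I_def
      by (rule integral_linear[OF _ bounded_linear_of_real, unfolded o_def, symmetric])
        (auto intro!: integrable_continuous_interval continuous_intros cont)
    also have "\<dots> = integral {0..1} (\<lambda>x. f x * cnj (f x))"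
      by (intro integral_cong) (simp only: complex_norm_square)
    also have "\<dots> = integral {0..1} (\<lambda>x. f x * cnj (f x) - f x * p (cis (2 * pi * x)))"
      by (subst integral_diff)
        (auto intro!: integrable_continuous_interval continuous_intros cont c simp: z)
    finally have eq: "I = cmod (integral {0..1} (\<lambda>x. f x * cnj (f x) - f x * p (cis (2 * pi * x))))"
      using I0 by (metis abs_of_nonneg norm_of_real)
    have "\<dots> \<le> integral {0..1} (\<lambda>x :: real. e)"
    proof (rule integral_norm_bound_integral)
      fix x :: real assume x: "x \<in> {0..1}"
      have "cmod (f x * cnj (f x) - f x * p (cis (2 * pi * x)))
          = cmod (f x) * cmod (cnj (d (cis (2 * pi * x))) - p (cis (2 * pi * x)))"
        using d[OF x] by (simp add: norm_mult[symmetric] right_diff_distrib)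
      also have "\<dots> \<le> B * (e / B)"
        using p(2)[of "cis (2 * pi * x)"] B(1)[OF x] B(2) e by (intro mult_mono) auto
      finally show "cmod (f x * cnj (f x) - f x * p (cis (2 * pi * x))) \<le> e" using B by simp
    qed (auto intro!: integrable_continuous_interval continuous_intros cont c)
    then show "I \<le> 0 + e" using eq by simp
  qed
  then have "I = 0" using I0 by simp
  then have "\<forall>x\<in>{0..1}. (cmod (f x))\<^sup>2 = 0"
    unfolding I_def
    by (subst (asm) integral_eq_0_iff) (auto intro!: continuous_intros cont)
  then show ?thesis using x by auto
qed

section \<open>Jacobi's inversion formula\<close>
lemma integral_cis:
  "integral {0..1} (\<lambda>x. cis (2 * pi * of_int k * x)) = (if k = 0 then 1 else 0)"
proof (cases "k = 0")
  case False
  have "((\<lambda>x. cis (2 * pi * of_int k * x)) has_integral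
      cis (2 * pi * of_int k * 1) / (2 * pi * of_int k * \<i>)
      - cis (2 * pi * of_int k * 0) / (2 * pi * of_int k * \<i>)) {0..1}"
  proof (rule fundamental_theorem_of_calculus)
    fix x :: real
    have "((\<lambda>z. exp (2 * pi * of_int k * \<i> * z) / (2 * pi * of_int k * \<i>))
        has_field_derivative exp (2 * pi * of_int k * \<i> * of_real x)) (at (of_real x))"
      using False by (auto intro!: derivative_eq_intros)
    from has_vector_derivative_real_field[OF this, of "{0..1}"]
    show "((\<lambda>x. cis (2 * pi * of_int k * x) / (2 * pi * of_int k * \<i>))
        has_vector_derivative cis (2 * pi * of_int k * x)) (at x within {0..1})"
      by (simp add: cis_conv_exp mult_ac)
  qed auto
  moreover have "cis (2 * pi * of_int k) = 1" by (rule cis_multiple_2pi) auto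
  ultimately show ?thesis using False by (simp add: integral_unique)
qed simp

text \<open>
  This is the characteristic function of the normal distribution, rescaled by
  \<open>sqrt (2h)\<close>.
\<close>
lemma gaussian_fourier:
  fixes h t :: real
  assumes h: "h > 0"
  shows "integrable lborel (\<lambda>x. exp (- h * x\<^sup>2) * cis (t * x))"
    and "(LINT x|lborel. exp (- h * x\<^sup>2) * cis (t * x)) = sqrt (pi / h) * exp (- t\<^sup>2 / (4 * h))"
proof -
  define s where "s = t / sqrt (2 * h)"
  have "complex_of_real (exp (- s\<^sup>2 / 2)) = char std_normal_distribution s"
    by (simp add: char_std_normal_distribution)
  also have "\<dots> = (LINT x|lborel. std_normal_density x *\<^sub>R iexp (s * x))"
    unfolding char_def by (subst integral_density) (auto simp: normal_density_nonneg)
  also have "\<dots> = \<bar>sqrt (2 * h)\<bar> *\<^sub>R (LINT x|lborel. std_normal_density (0 + sqrt (2 * h) * x) *\<^sub>R iexp (s * (0 + sqrt (2 * h) * x)))"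
    using h by (intro lborel_integral_real_affine) auto
  also have "(\<lambda>x. std_normal_density (0 + sqrt (2 * h) * x) *\<^sub>R iexp (s * (0 + sqrt (2 * h) * x)))
      = (\<lambda>x. (1 / sqrt (2 * pi)) * (exp (- h * x\<^sup>2) * cis (t * x)))"
    using h by (auto simp: std_normal_density_def s_def cis_conv_exp power_mult_distrib scaleR_conv_of_real)
  also have "(LINT x|lborel. complex_of_real (1 / sqrt (2 * pi)) * (exp (- h * x\<^sup>2) * cis (t * x)))
      = (1 / sqrt (2 * pi)) * (LINT x|lborel. exp (- h * x\<^sup>2) * cis (t * x))"
    by simp
  finally have *: "complex_of_real (exp (- s\<^sup>2 / 2))
      = sqrt (h / pi) * (LINT x|lborel. exp (- h * x\<^sup>2) * cis (t * x))"
    using h by (simp add: scaleR_conv_of_real real_sqrt_mult real_sqrt_divide)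
  have "complex_of_real (sqrt (pi / h)) * complex_of_real (sqrt (h / pi)) = 1"
    using h by (simp flip: of_real_mult real_sqrt_mult)
  then have "(LINT x|lborel. exp (- h * x\<^sup>2) * cis (t * x)) = sqrt (pi / h) * exp (- s\<^sup>2 / 2)"
    by (simp only: of_real_mult * mult.assoc[symmetric] mult_1)
  also have "- s\<^sup>2 / 2 = - t\<^sup>2 / (4 * h)"
    using h by (simp add: s_def power_divide)
  finally show eq: "(LINT x|lborel. exp (- h * x\<^sup>2) * cis (t * x)) = sqrt (pi / h) * exp (- t\<^sup>2 / (4 * h))"
    by simp
  show "integrable lborel (\<lambda>x. exp (- h * x\<^sup>2) * cis (t * x))"
  proof (rule ccontr)
    \<comment> \<open>The integral of a function that is not integrable is \<open>0\<close> by convention.\<close>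
    assume "\<not> ?thesis"
    then have "(LINT x|lborel. exp (- h * x\<^sup>2) * cis (t * x)) = 0"
      by (rule not_integrable_integral_eq)
    with eq h show False by simp
  qed
qed

lemma infsum_complex_of_real:
  "infsum (\<lambda>x. complex_of_real (f x)) A = complex_of_real (infsum f A)"
proof (rule infsum_bounded_linear_strong[OF _ bounded_linear_of_real])
  show "(\<lambda>x. complex_of_real (f x)) summable_on A \<longleftrightarrow> f summable_on A"
    by (rule summable_on_bounded_linear_iff[OF bounded_linear_of_real bounded_linear_Re]) simp
qed

lemma has_sum_int:
  fixes f :: "int \<Rightarrow> 'a :: {topological_comm_monoid_add, t2_space}"
  assumes "((\<lambda>n. f (int n)) has_sum a) UNIV" "((\<lambda>n. f (- int (Suc n))) has_sum b) UNIV"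
  shows "(f has_sum (a + b)) UNIV"
proof -
  have "(f has_sum a) (range int)"
    using assms(1) by (subst has_sum_reindex) (auto simp: o_def)
  moreover have "(f has_sum b) (range (\<lambda>n. - int (Suc n)))"
    using assms(2) by (subst has_sum_reindex) (auto simp: o_def inj_on_def)
  moreover have "range int \<inter> range (\<lambda>n. - int (Suc n)) = {}" by auto
  ultimately have "(f has_sum (a + b)) (range int \<union> range (\<lambda>n. - int (Suc n)))"
    by (rule has_sum_Un_disjoint)
  moreover have "range int \<union> range (\<lambda>n. - int (Suc n)) = UNIV"
  proof (intro equalityI subsetI UNIV_I)
    fix x :: int
    show "x \<in> range int \<union> range (\<lambda>n. - int (Suc n))" by (cases x) auto
  qed
  ultimately show ?thesis by simp
qed

lemma summable_on_gaussian:
  fixes c :: real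
  assumes "c > 0"
  shows "(\<lambda>n::int. exp (- c * (of_int n)\<^sup>2)) summable_on UNIV"
proof -
  have "summable (\<lambda>n. exp (- c) ^ n)"
    using assms by (intro summable_geometric) simp
  then have s: "summable (\<lambda>n::nat. exp (- c * (real n)\<^sup>2))"
  proof (rule summable_comparison_test_ev[rotated], intro always_eventually allI)
    fix n :: nat
    have "real n \<le> (real n)\<^sup>2"
      by (cases n) (auto simp: power2_eq_square)
    then have "- c * (real n)\<^sup>2 \<le> of_nat n * (- c)" using assms by simp
    then show "norm (exp (- c * (real n)\<^sup>2)) \<le> exp (- c) ^ n"
      by (simp only: exp_of_nat_mult[symmetric] real_norm_def abs_exp_cancel exp_le_cancel_iff)
  qed
  then have "(\<lambda>n::nat. exp (- c * (real n)\<^sup>2)) summable_on UNIV"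
    by (simp add: summable_on_UNIV_nonneg_real_iff)
  moreover have "(\<lambda>n::nat. exp (- c * (real (Suc n))\<^sup>2)) summable_on UNIV"
    using summable_Suc_iff[of "\<lambda>n. exp (- c * (real n)\<^sup>2)"] s
    by (subst summable_on_UNIV_nonneg_real_iff) auto
  ultimately obtain a b where
    "((\<lambda>n::nat. exp (- c * (real n)\<^sup>2)) has_sum a) UNIV"
    "((\<lambda>n::nat. exp (- c * (real (Suc n))\<^sup>2)) has_sum b) UNIV"
    unfolding summable_on_def by blast
  then have "((\<lambda>n::int. exp (- c * (of_int n)\<^sup>2)) has_sum (a + b)) UNIV"
    by (intro has_sum_int) (simp_all add: power2_eq_square algebra_simps)
  then show ?thesis unfolding summable_on_def by blast
qed

text \<open>
  From \<open>(x + n)\<^sup>2 \<ge> n\<^sup>2/2 - x\<^sup>2\<close>; it makes the periodized Gaussian converge uniformly on a period.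
\<close>
lemma periodization_tail_bound:
  fixes h x :: real
  assumes "h > 0" "x \<in> {0..1}"
  shows "exp (- h * (x + of_int n)\<^sup>2) \<le> exp h * exp (- (h / 2) * (of_int n)\<^sup>2)"
proof -
  have "x\<^sup>2 \<le> 1" using assms(2) by (simp add: power_le_one)
  moreover have "0 \<le> (of_int n + 2 * x)\<^sup>2 / 2" by simp
  moreover have "(of_int n + 2 * x)\<^sup>2 / 2 = (x + of_int n)\<^sup>2 - (of_int n)\<^sup>2 / 2 + x\<^sup>2"
    by (simp add: power2_eq_square field_simps)
  ultimately have "(of_int n)\<^sup>2 / 2 - 1 \<le> (x + of_int n)\<^sup>2" by linarith
  then have "h * ((of_int n)\<^sup>2 / 2 - 1) \<le> h * (x + of_int n)\<^sup>2"
    using assms(1) by (intro mult_left_mono) auto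
  then show ?thesis by (simp add: exp_add[symmetric] algebra_simps)
qed

lemma periodization_summable:
  fixes h x :: real
  assumes "h > 0" "x \<in> {0..1}"
  shows "(\<lambda>n::int. exp (- h * (x + of_int n)\<^sup>2)) summable_on UNIV"
proof (rule summable_on_comparison_test)
  show "(\<lambda>n::int. exp h * exp (- (h / 2) * (of_int n)\<^sup>2)) summable_on UNIV"
    using assms(1) by (intro summable_on_cmult_right summable_on_gaussian) auto
qed (use periodization_tail_bound[OF assms] in auto)

text \<open>
  The unfolding step of Poisson summation. The unordered sum is computed along the windows
  \<open>{-N..<N}\<close>, over which the integrals fill the interval from \<open>-N\<close> to \<open>N\<close>.
\<close>
lemma periodization_integral:
  fixes g :: "real \<Rightarrow> complex"
  assumes g: "integrable lborel g" "continuous_on UNIV g"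
    and s: "((\<lambda>n::int. integral {0..1} (\<lambda>x. g (x + of_int n))) has_sum S) UNIV"
  shows "S = integral\<^sup>L lborel g"
proof -
  have part: "(\<Sum>n\<in>{- int N..<int N}. integral {0..1} (\<lambda>x. g (x + of_int n))) = integral {- real N..real N} g" for N
  proof (induction N)
    case (Suc N)
    have sh: "integral {0..1} (\<lambda>x. g (x + of_int n)) = integral {of_int n..of_int n + 1} g" for n :: int
      using integral_shift_Icc_real[of 0 1 g "of_int n"] by (simp add: o_def add.commute)
    have i: "g integrable_on {a..b}" for a b
      by (intro integrable_continuous_interval continuous_on_subset[OF g(2)]) auto
    have "{- int (Suc N)..<int (Suc N)} = insert (- int (Suc N)) (insert (int N) {- int N..<int N})" by auto
    then have "(\<Sum>n\<in>{- int (Suc N)..<int (Suc N)}. integral {0..1} (\<lambda>x. g (x + of_int n)))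
        = integral {- 1 - real N..- real N} g + (integral {- real N..real N} g + integral {real N..1 + real N} g)"
      using Suc.IH sh[of "- int (Suc N)"] sh[of "int N"] by (simp add: ac_simps)
    also have "\<dots> = integral {- 1 - real N..1 + real N} g"
      by (simp add: Henstock_Kurzweil_Integration.integral_combine i)
    finally show ?case by (simp add: algebra_simps)
  qed simp
  have "filterlim (\<lambda>N. {- int N..<int N}) (finite_subsets_at_top UNIV) sequentially"
    unfolding filterlim_finite_subsets_at_top
  proof (intro allI impI)
    fix X :: "int set" assume X: "finite X \<and> X \<subseteq> UNIV"
    obtain b where b: "\<And>x. x \<in> X \<Longrightarrow> \<bar>x\<bar> \<le> b"
      using X by (metis finite_abs_int_segment finite_imageI Max_ge imageI)
    show "\<forall>\<^sub>F N in sequentially. finite {- int N..<int N} \<and> X \<subseteq> {- int N..<int N} \<and> {- int N..<int N} \<subseteq> UNIV"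
      using eventually_ge_at_top[of "nat (b + 1)"]
    proof eventually_elim
      case (elim N)
      then show ?case using b by (fastforce simp: abs_le_iff)
    qed
  qed
  from filterlim_compose[OF s[unfolded has_sum_def] this]
  have lim: "(\<lambda>N. integral {- real N..real N} g) \<longlonglongrightarrow> S"
    by (simp add: part)
  have "(\<lambda>N. LINT x|lborel. indicator {- real N..real N} x *\<^sub>R g x) \<longlonglongrightarrow> integral\<^sup>L lborel g"
  proof (rule integral_dominated_convergence)
    show "integrable lborel (\<lambda>x. norm (g x))" using g(1) by simp
    show "AE x in lborel. (\<lambda>N. indicator {- real N..real N} x *\<^sub>R g x) \<longlonglongrightarrow> g x"
    proof (intro AE_I2 tendsto_eventually)
      fix x :: real
      show "\<forall>\<^sub>F N in sequentially. indicator {- real N..real N} x *\<^sub>R g x = g x"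
        using eventually_ge_at_top[of "nat \<lceil>\<bar>x\<bar>\<rceil>"]
        by eventually_elim (auto simp: indicator_def abs_le_iff nat_le_iff ceiling_le_iff)
    qed
  qed (use g(1) in \<open>auto simp: indicator_def intro!: borel_measurable_integrable\<close>)
  moreover have "(LINT x|lborel. indicator {- real N..real N} x *\<^sub>R g x) = integral {- real N..real N} g" for N
    using set_borel_integral_eq_integral(2)[of "{- real N..real N}" g] integrable_mult_indicator[OF _ g(1), of "{- real N..real N}"]
    by (simp add: set_lebesgue_integral_def set_integrable_def)
  ultimately have "(\<lambda>N. integral {- real N..real N} g) \<longlonglongrightarrow> integral\<^sup>L lborel g" by simp
  with lim show ?thesis by (rule LIMSEQ_unique)
qed

lemma has_sum_integral_m_test:
  fixes f :: "'i \<Rightarrow> real \<Rightarrow> complex"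
  assumes "\<And>n x. x \<in> {a..b} \<Longrightarrow> norm (f n x) \<le> M n" "M summable_on UNIV"
    and "\<And>n. continuous_on {a..b} (f n)"
  shows "((\<lambda>n. integral {a..b} (f n)) has_sum integral {a..b} (\<lambda>x. \<Sum>\<^sub>\<infinity>n\<in>UNIV. f n x)) UNIV"
proof -
  have "uniform_limit {a..b} (\<lambda>X x. \<Sum>n\<in>X. f n x) (\<lambda>x. \<Sum>\<^sub>\<infinity>n\<in>UNIV. f n x) (finite_subsets_at_top UNIV)"
    by (rule Weierstrass_m_test_general[OF assms(1,2)])
  then obtain I J where IJ: "\<And>X. ((\<lambda>x. \<Sum>n\<in>X. f n x) has_integral I X) {a..b}"
      "((\<lambda>x. \<Sum>\<^sub>\<infinity>n\<in>UNIV. f n x) has_integral J) {a..b}" "(I \<longlongrightarrow> J) (finite_subsets_at_top UNIV)"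
    by (rule uniform_limit_integral) (auto intro!: continuous_intros assms(3))
  have "\<forall>\<^sub>F X in finite_subsets_at_top UNIV. I X = (\<Sum>n\<in>X. integral {a..b} (f n))"
  proof (rule eventually_finite_subsets_at_top_weakI)
    fix X :: "'i set" assume "finite X"
    then show "I X = (\<Sum>n\<in>X. integral {a..b} (f n))"
      using integral_unique[OF IJ(1)[of X]] integral_sum[of X f "{a..b}"] assms(3)
      by (simp add: integrable_continuous_interval)
  qed
  then have "((\<lambda>X. \<Sum>n\<in>X. integral {a..b} (f n)) \<longlongrightarrow> J) (finite_subsets_at_top UNIV)"
    using IJ(3) tendsto_cong by blast
  then show ?thesis using integral_unique[OF IJ(2)] by (simp add: has_sum_def)
qed

text \<open>
  The difference of the two sides satisfies the hypotheses of \<open>vanishing_fourier_imp_zero\<close>: both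
  have the \<open>m\<close>-th coefficient \<open>sqrt (\<pi>/h)\<close> times \<open>exp (-\<pi>\<^sup>2m\<^sup>2/h)\<close>.
\<close>
theorem jacobi_inversion_unit_interval:
  fixes h x :: real
  assumes h: "h > 0" and x: "x \<in> {0..1}"
  shows "complex_of_real (\<Sum>\<^sub>\<infinity>n\<in>(UNIV::int set). exp (- h * (x + of_int n)\<^sup>2))
    = sqrt (pi / h) * (\<Sum>\<^sub>\<infinity>n\<in>(UNIV::int set). exp (- pi\<^sup>2 / h * (of_int n)\<^sup>2) * cis (2 * pi * of_int n * x))"
proof -
  define e where "e n x = complex_of_real (exp (- h * (x + of_int n)\<^sup>2))" for n :: int and x
  define c where "c n x = exp (- pi\<^sup>2 / h * (of_int n)\<^sup>2) * cis (2 * pi * of_int n * x)" for n :: int and x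
  define F where "F x = (\<Sum>\<^sub>\<infinity>n\<in>UNIV. e n x)" for x
  define G where "G x = (\<Sum>\<^sub>\<infinity>n\<in>UNIV. c n x)" for x
  have Me: "(\<lambda>n::int. exp h * exp (- (h / 2) * (of_int n)\<^sup>2)) summable_on UNIV"
    using h by (intro summable_on_cmult_right summable_on_gaussian) auto
  have be: "cmod (e n x) \<le> exp h * exp (- (h / 2) * (of_int n)\<^sup>2)" if "x \<in> {0..1}" for n x
    unfolding e_def norm_of_real using periodization_tail_bound[OF h that] by simp
  have Mc: "(\<lambda>n::int. exp (- (pi\<^sup>2 / h) * (of_int n)\<^sup>2)) summable_on UNIV"
    using h by (intro summable_on_gaussian) auto
  have bc: "cmod (c n x) \<le> exp (- (pi\<^sup>2 / h) * (of_int n)\<^sup>2)" for n x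
    by (simp add: c_def norm_mult)
  have ue: "uniform_limit {0..1} (\<lambda>X x. \<Sum>n\<in>X. e n x) F (finite_subsets_at_top UNIV)"
    unfolding F_def by (rule Weierstrass_m_test_general[OF be Me])
  have uc: "uniform_limit {0..1} (\<lambda>X x. \<Sum>n\<in>X. c n x) G (finite_subsets_at_top UNIV)"
    unfolding G_def by (rule Weierstrass_m_test_general[OF bc Mc])
  have ce: "continuous_on S (e n)" for S n unfolding e_def by (intro continuous_intros)
  have cc: "continuous_on S (c n)" for S n unfolding c_def by (intro continuous_intros)
  have contF: "continuous_on {0..1} F"
    by (rule uniform_limit_theorem[OF _ ue]) (auto intro!: always_eventually continuous_intros ce)
  have contG: "continuous_on {0..1} G"
    by (rule uniform_limit_theorem[OF _ uc]) (auto intro!: always_eventually continuous_intros cc)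
  define w where "w m x = cis (2 * pi * of_int m * x)" for m :: int and x
  have cw: "continuous_on S (w m)" for S m unfolding w_def by (intro continuous_intros)
  have nw: "cmod (w m x) = 1" for m x by (simp add: w_def)
  have hasF: "((\<lambda>n. integral {0..1} (\<lambda>x. e n x * w m x)) has_sum integral {0..1} (\<lambda>x. F x * w m x)) UNIV" for m
  proof -
    have "((\<lambda>n. integral {0..1} (\<lambda>x. e n x * w m x)) has_sum
        integral {0..1} (\<lambda>x. \<Sum>\<^sub>\<infinity>n\<in>UNIV. e n x * w m x)) UNIV"
      by (rule has_sum_integral_m_test[OF _ Me], simp only: norm_mult nw mult_1_right be)
        (intro continuous_intros ce cw)
    then show ?thesis unfolding F_def by (simp add: infsum_cmult_left')
  qed
  have hasG: "((\<lambda>n. integral {0..1} (\<lambda>x. c n x * w m x)) has_sum integral {0..1} (\<lambda>x. G x * w m x)) UNIV" for m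
  proof -
    have "((\<lambda>n. integral {0..1} (\<lambda>x. c n x * w m x)) has_sum
        integral {0..1} (\<lambda>x. \<Sum>\<^sub>\<infinity>n\<in>UNIV. c n x * w m x)) UNIV"
      by (rule has_sum_integral_m_test[OF _ Mc], simp only: norm_mult nw mult_1_right bc)
        (intro continuous_intros cc cw)
    then show ?thesis unfolding G_def by (simp add: infsum_cmult_left')
  qed
  have coefF: "integral {0..1} (\<lambda>x. F x * w m x) = sqrt (pi / h) * exp (- pi\<^sup>2 / h * (of_int m)\<^sup>2)" for m
  proof -
    define g where "g x = complex_of_real (exp (- h * x\<^sup>2)) * cis (2 * pi * of_int m * x)" for x
    have "g (x + of_int n) = e n x * w m x" for n x
    proof -
      have "cis (2 * pi * of_int m * (x + of_int n)) = cis (2 * pi * of_int m * x) * cis (2 * pi * of_int (m * n))"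
        by (simp add: cis_mult algebra_simps)
      also have "cis (2 * pi * of_int (m * n)) = 1" by (rule cis_multiple_2pi) (rule Ints_of_int)
      finally show ?thesis by (simp add: g_def e_def w_def)
    qed
    then have "integral {0..1} (\<lambda>x. F x * w m x) = integral\<^sup>L lborel g"
      using hasF[of m] gaussian_fourier(1)[OF h, of "2 * pi * of_int m"]
      by (intro periodization_integral) (auto simp: g_def[abs_def] intro!: continuous_intros)
    also have "\<dots> = sqrt (pi / h) * exp (- (2 * pi * of_int m)\<^sup>2 / (4 * h))"
      using gaussian_fourier(2)[OF h, of "2 * pi * of_int m"] by (simp add: g_def[abs_def])
    also have "- (2 * pi * of_int m)\<^sup>2 / (4 * h) = - pi\<^sup>2 / h * (of_int m)\<^sup>2"
      by (simp add: power_mult_distrib)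
    finally show ?thesis .
  qed
  have coefG: "integral {0..1} (\<lambda>x. G x * w m x) = exp (- pi\<^sup>2 / h * (of_int m)\<^sup>2)" for m
  proof -
    have eq: "integral {0..1} (\<lambda>x. c n x * w m x)
        = (if n = - m then exp (- pi\<^sup>2 / h * (of_int m)\<^sup>2) else 0)" for n
    proof -
      have "integral {0..1} (\<lambda>x. c n x * w m x)
          = integral {0..1} (\<lambda>x. exp (- pi\<^sup>2 / h * (of_int n)\<^sup>2) * cis (2 * pi * of_int (n + m) * x))"
        by (intro integral_cong) (simp add: c_def w_def cis_mult algebra_simps)
      also have "\<dots> = complex_of_real (exp (- pi\<^sup>2 / h * (of_int n)\<^sup>2)) * (if n + m = 0 then 1 else 0)"
        unfolding integral_cis[symmetric] by (rule integral_mult_right)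
      also have "n + m = 0 \<longleftrightarrow> n = - m" by linarith
      finally show ?thesis by (cases "n = - m") simp_all
    qed
    have "((\<lambda>n. integral {0..1} (\<lambda>x. c n x * w m x)) has_sum of_real (exp (- pi\<^sup>2 / h * (of_int m)\<^sup>2))) UNIV"
      unfolding eq by (rule has_sum_finite_neutralI[of "{- m}"]) simp_all
    then show ?thesis by (rule has_sum_unique[OF hasG])
  qed
  define D where "D x = F x - sqrt (pi / h) * G x" for x
  have "vanishing_fourier D"
    unfolding vanishing_fourier_def
  proof (intro conjI allI)
    show "continuous_on {0..1} D" unfolding D_def by (intro continuous_intros contF contG)
    fix m :: int
    have "integral {0..1} (\<lambda>x. D x * w m x)
        = integral {0..1} (\<lambda>x. F x * w m x - sqrt (pi / h) * (G x * w m x))"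
      by (simp add: D_def algebra_simps)
    also have "\<dots> = integral {0..1} (\<lambda>x. F x * w m x) - sqrt (pi / h) * integral {0..1} (\<lambda>x. G x * w m x)"
      by (subst integral_diff)
        (auto intro!: integrable_continuous_interval continuous_intros contF contG cw)
    also have "\<dots> = 0" by (simp add: coefF coefG)
    finally show "integral {0..1} (\<lambda>x. D x * cis (2 * pi * of_int m * x)) = 0" by (simp add: w_def)
  qed
  moreover have "D 0 = D 1"
  proof -
    have "F 0 = (\<Sum>\<^sub>\<infinity>n\<in>UNIV. e (n + 1) 0)"
      unfolding F_def by (rule infsum_reindex_bij_betw[symmetric]) (rule bij_betw_byWitness[of _ "\<lambda>n. n - 1"], auto)
    also have "\<dots> = F 1" by (simp add: F_def e_def add.commute)
    finally have "F 0 = F 1" .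
    moreover have "c n 1 = c n 0" for n
      using cis_multiple_2pi[of "of_int n"] by (simp add: c_def)
    ultimately show ?thesis by (simp add: D_def G_def)
  qed
  ultimately have "D x = 0" using x by (rule vanishing_fourier_imp_zero)
  then have "F x = sqrt (pi / h) * G x" by (simp add: D_def)
  moreover have "F x = complex_of_real (\<Sum>\<^sub>\<infinity>n\<in>(UNIV::int set). exp (- h * (x + of_int n)\<^sup>2))"
    unfolding F_def e_def by (rule infsum_complex_of_real)
  ultimately show ?thesis by (simp add: G_def c_def)
qed

definition periodized_gaussian :: "real \<Rightarrow> real \<Rightarrow> real" where
  "periodized_gaussian h x = (\<Sum>\<^sub>\<infinity>n\<in>(UNIV::int set). exp (- h * (x + of_int n)\<^sup>2))"

lemma periodized_gaussian_frac: "periodized_gaussian h x = periodized_gaussian h (frac x)"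
proof -
  have "periodized_gaussian h (frac x)
      = (\<Sum>\<^sub>\<infinity>n\<in>(UNIV::int set). exp (- h * (frac x + of_int (n + \<lfloor>x\<rfloor>))\<^sup>2))"
    unfolding periodized_gaussian_def
    by (rule infsum_reindex_bij_betw[symmetric])
      (rule bij_betw_byWitness[of _ "\<lambda>n. n - \<lfloor>x\<rfloor>"], auto)
  then show ?thesis by (simp add: periodized_gaussian_def frac_def)
qed

lemma periodized_gaussian_pos:
  assumes "h > 0" shows "periodized_gaussian h x > 0"
proof -
  let ?y = "frac x"
  have y: "?y \<in> {0..1}" using frac_ge_0[of x] frac_lt_1[of x] by auto
  have "(\<Sum>n\<in>{0::int}. exp (- h * (?y + of_int n)\<^sup>2)) \<le> periodized_gaussian h ?y"
    unfolding periodized_gaussian_def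
    by (rule finite_sum_le_infsum[OF periodization_summable[OF assms y]]) auto
  then have "exp (- h * ?y\<^sup>2) \<le> periodized_gaussian h ?y" by simp
  then show ?thesis
    unfolding periodized_gaussian_frac[of h x] using exp_gt_zero[of "- h * ?y\<^sup>2"] by linarith
qed

theorem jacobi_inversion:
  assumes h: "h > 0"
  shows "complex_of_real (periodized_gaussian h x)
    = sqrt (pi / h) * (\<Sum>\<^sub>\<infinity>n\<in>(UNIV::int set). exp (- pi\<^sup>2 / h * (of_int n)\<^sup>2) * cis (2 * pi * of_int n * x))"
proof -
  have "cis (2 * pi * of_int n * x) = cis (2 * pi * of_int n * frac x)" for n :: int
  proof -
    have "cis (2 * pi * of_int n * x) = cis (2 * pi * of_int n * frac x) * cis (2 * pi * of_int (n * \<lfloor>x\<rfloor>))"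
      by (simp add: cis_mult frac_def algebra_simps)
    also have "cis (2 * pi * of_int (n * \<lfloor>x\<rfloor>)) = 1" by (rule cis_multiple_2pi) (rule Ints_of_int)
    finally show ?thesis by simp
  qed
  then show ?thesis
    using jacobi_inversion_unit_interval[OF h, of "frac x"] frac_ge_0[of x] frac_lt_1[of x]
    by (subst periodized_gaussian_frac) (simp add: periodized_gaussian_def)
qed

section \<open>The dual theta series\<close>

text \<open>
  The \<open>j\<close>-th derivative in \<open>\<phi>\<close> of \<open>theta (\<i>\<phi>) q - 1\<close>. A derivative of a cosine is a shift of its
  phase by \<open>\<pi>/2\<close>, which puts all orders into one formula. The sum runs over \<open>Suc n\<close> and the
  factor \<open>2\<close> accounts for the negative frequencies.
\<close>
definition tail_deriv :: "nat \<Rightarrow> real \<Rightarrow> real \<Rightarrow> real" where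
  "tail_deriv j q \<phi> = (\<Sum>n. 2 * real (Suc n) ^ j * q ^ ((Suc n)\<^sup>2) * cos (real (Suc n) * \<phi> + real j * (pi / 2)))"

lemma summable_tail_coeff:
  fixes q :: real
  assumes "0 < q" "q < 1"
  shows "summable (\<lambda>n. 2 * real (Suc n) ^ j * q ^ ((Suc n)\<^sup>2))"
proof -
  have bigo: "(\<lambda>n. real (Suc n) ^ j * q ^ Suc n) \<in> O(\<lambda>n. 1 / real n ^ 2)"
    using assms by real_asymp
  have "summable (\<lambda>n. norm (1 / real n ^ 2))"
    using inverse_power_summable[of 2, where 'a = real] by (simp add: field_simps)
  then have "summable (\<lambda>n. real (Suc n) ^ j * q ^ Suc n)"
    by (rule summable_comparison_test_bigo[OF _ bigo])
  then have "summable (\<lambda>n. 2 * (real (Suc n) ^ j * q ^ Suc n))" by (rule summable_mult)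
  then show ?thesis
  proof (rule summable_comparison_test_ev[rotated], intro always_eventually allI)
    fix n
    have "q ^ ((Suc n)\<^sup>2) \<le> q ^ Suc n"
      using assms by (intro power_decreasing) (auto simp: power2_eq_square)
    then show "norm (2 * real (Suc n) ^ j * q ^ ((Suc n)\<^sup>2)) \<le> 2 * (real (Suc n) ^ j * q ^ Suc n)"
      using assms(1) by (simp add: abs_mult mult_left_mono)
  qed
qed

lemma summable_tail_deriv:
  assumes "0 < q" "q < 1"
  shows "summable (\<lambda>n. 2 * real (Suc n) ^ j * q ^ ((Suc n)\<^sup>2) * cos (real (Suc n) * \<phi> + real j * (pi / 2)))"
proof (rule summable_comparison_test_ev[OF _ summable_tail_coeff[OF assms, of j]], intro always_eventually allI)
  fix n
  have "\<bar>2 * real (Suc n) ^ j * q ^ ((Suc n)\<^sup>2)\<bar> * \<bar>cos (real (Suc n) * \<phi> + real j * (pi / 2))\<bar>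
      \<le> \<bar>2 * real (Suc n) ^ j * q ^ ((Suc n)\<^sup>2)\<bar> * 1"
    by (intro mult_left_mono) auto
  then show "norm (2 * real (Suc n) ^ j * q ^ ((Suc n)\<^sup>2) * cos (real (Suc n) * \<phi> + real j * (pi / 2)))
    \<le> 2 * real (Suc n) ^ j * q ^ ((Suc n)\<^sup>2)"
    using assms by (simp add: abs_mult)
qed

lemma DERIV_tail_deriv:
  assumes "0 < q" "q < 1"
  shows "(tail_deriv j q has_field_derivative tail_deriv (Suc j) q \<phi>) (at \<phi>)"
  unfolding tail_deriv_def[abs_def]
proof (rule has_field_derivative_series'(2)[where S = UNIV and ?x0.0 = 0])
  show "((\<lambda>x. 2 * real (Suc n) ^ j * q ^ ((Suc n)\<^sup>2) * cos (real (Suc n) * x + real j * (pi / 2)))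
      has_field_derivative 2 * real (Suc n) ^ Suc j * q ^ ((Suc n)\<^sup>2)
        * cos (real (Suc n) * x + real (Suc j) * (pi / 2))) (at x within UNIV)" for n x
  proof -
    have "real (Suc j) * (pi / 2) = real j * (pi / 2) + pi / 2" by (simp add: field_simps)
    then have "cos (real (Suc n) * x + real (Suc j) * (pi / 2)) = - sin (real (Suc n) * x + real j * (pi / 2))"
      by (simp only: add.assoc[symmetric] cos_add) simp
    then show ?thesis by (auto intro!: derivative_eq_intros)
  qed
  show "uniformly_convergent_on UNIV (\<lambda>n x. \<Sum>i<n. 2 * real (Suc i) ^ Suc j * q ^ ((Suc i)\<^sup>2)
      * cos (real (Suc i) * x + real (Suc j) * (pi / 2)))"
  proof (rule Weierstrass_m_test'[OF _ summable_tail_coeff[OF assms, of "Suc j"]])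
    fix n x
    have "\<bar>2 * real (Suc n) ^ Suc j * q ^ ((Suc n)\<^sup>2)\<bar> * \<bar>cos (real (Suc n) * x + real (Suc j) * (pi / 2))\<bar>
        \<le> \<bar>2 * real (Suc n) ^ Suc j * q ^ ((Suc n)\<^sup>2)\<bar> * 1"
      by (intro mult_left_mono) auto
    then show "norm (2 * real (Suc n) ^ Suc j * q ^ ((Suc n)\<^sup>2) * cos (real (Suc n) * x + real (Suc j) * (pi / 2)))
      \<le> 2 * real (Suc n) ^ Suc j * q ^ ((Suc n)\<^sup>2)"
      using assms by (simp add: abs_mult)
  qed
  show "summable (\<lambda>n. 2 * real (Suc n) ^ j * q ^ ((Suc n)\<^sup>2) * cos (real (Suc n) * 0 + real j * (pi / 2)))"
    by (rule summable_tail_deriv[OF assms])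
qed auto

definition tail_bound :: "nat \<Rightarrow> real" where
  "tail_bound j = 2 * (\<Sum>n. 2 * real (Suc n) ^ j * (1 / 2) ^ ((Suc n)\<^sup>2))"

text \<open>
  Since \<open>(Suc n)\<^sup>2 \<ge> 1\<close>, one factor \<open>q\<close> splits off from every term; the others are estimated by
  \<open>1/2\<close>.
\<close>
lemma tail_deriv_bound:
  assumes q: "0 < q" "q \<le> 1 / 2"
  shows "\<bar>tail_deriv j q \<phi>\<bar> \<le> tail_bound j * q"
proof -
  have c: "summable (\<lambda>n. 2 * real (Suc n) ^ j * (1 / 2 :: real) ^ ((Suc n)\<^sup>2))"
    by (rule summable_tail_coeff) auto
  have "norm (\<Sum>n. 2 * real (Suc n) ^ j * q ^ ((Suc n)\<^sup>2) * cos (real (Suc n) * \<phi> + real j * (pi / 2)))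
      \<le> (\<Sum>n. 2 * q * (2 * real (Suc n) ^ j * (1 / 2) ^ ((Suc n)\<^sup>2)))"
  proof (rule norm_suminf_le)
    fix n
    obtain m where m: "(Suc n)\<^sup>2 = Suc m" by (metis not0_implies_Suc power_not_zero nat.distinct(1))
    have "q ^ Suc m = q * q ^ m" by simp
    also have "\<dots> \<le> q * (1 / 2) ^ m" using q by (intro mult_left_mono power_mono) auto
    finally have le: "q ^ ((Suc n)\<^sup>2) \<le> 2 * q * (1 / 2) ^ ((Suc n)\<^sup>2)" unfolding m by simp
    have "\<bar>2 * real (Suc n) ^ j * q ^ ((Suc n)\<^sup>2)\<bar> * \<bar>cos (real (Suc n) * \<phi> + real j * (pi / 2))\<bar>
        \<le> \<bar>2 * real (Suc n) ^ j * q ^ ((Suc n)\<^sup>2)\<bar> * 1"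
      by (intro mult_left_mono) auto
    also have "\<dots> = 2 * real (Suc n) ^ j * q ^ ((Suc n)\<^sup>2)"
      using q by (simp add: abs_mult)
    also have "\<dots> \<le> 2 * real (Suc n) ^ j * (2 * q * (1 / 2) ^ ((Suc n)\<^sup>2))"
      by (intro mult_left_mono le) auto
    finally show "norm (2 * real (Suc n) ^ j * q ^ ((Suc n)\<^sup>2) * cos (real (Suc n) * \<phi> + real j * (pi / 2)))
        \<le> 2 * q * (2 * real (Suc n) ^ j * (1 / 2) ^ ((Suc n)\<^sup>2))"
      by (simp add: abs_mult mult_ac)
  qed (rule summable_mult[OF c])
  also have "\<dots> = tail_bound j * q"
    by (subst suminf_mult[OF c]) (simp add: tail_bound_def)
  finally show ?thesis by (simp add: tail_deriv_def)
qed

lemma tail_bound_nonneg: "0 \<le> tail_bound j"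
  unfolding tail_bound_def
  using suminf_nonneg[OF summable_tail_coeff[of "1/2" j]] by simp

lemma theta_tail_has_sum:
  assumes q: "0 < q" "q < 1"
  shows "((\<lambda>n. of_real (q powi (n\<^sup>2)) * exp (of_int n * (\<i> * of_real \<phi>)))
      has_sum complex_of_real (tail_deriv 0 q \<phi>)) (UNIV - {0 :: int})"
    (is "(?f has_sum _) _")
proof -
  define u where "u n = complex_of_real (q ^ ((Suc n)\<^sup>2)) * cis (real (Suc n) * \<phi>)" for n
  have q2: "q powi ((int (Suc n))\<^sup>2) = q ^ ((Suc n)\<^sup>2)" for n
    by (metis of_nat_power power_int_of_nat)
  have su: "summable (\<lambda>n. norm (u n))"
    using summable_divide[OF summable_tail_coeff[OF q, of 0], of 2] q
    by (simp add: u_def norm_mult norm_power)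
  then have sc: "summable (\<lambda>n. norm (cnj (u n)))" by simp
  have pos: "(\<lambda>n. ?f (int (Suc n))) = u"
    unfolding q2 by (simp add: u_def[abs_def] cis_conv_exp mult_ac)
  have neg: "(\<lambda>n. ?f (- int (Suc n))) = (\<lambda>n. cnj (u n))"
    unfolding power2_minus q2 by (simp add: u_def cis_cnj cis_conv_exp exp_cnj mult_ac del: of_nat_Suc)
  have "((\<lambda>n. ?f (int (Suc n))) has_sum suminf u) UNIV"
    unfolding pos by (rule norm_summable_imp_has_sum[OF su summable_sums[OF summable_norm_cancel[OF su]]])
  then have a: "(?f has_sum suminf u) (range (\<lambda>n. int (Suc n)))"
    by (subst has_sum_reindex) (auto simp: o_def inj_on_def)
  have "((\<lambda>n. ?f (- int (Suc n))) has_sum (\<Sum>n. cnj (u n))) UNIV"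
    unfolding neg by (rule norm_summable_imp_has_sum[OF sc summable_sums[OF summable_norm_cancel[OF sc]]])
  then have b: "(?f has_sum (\<Sum>n. cnj (u n))) (range (\<lambda>n. - int (Suc n)))"
    by (subst has_sum_reindex) (auto simp: o_def inj_on_def)
  have "range (\<lambda>n. int (Suc n)) \<union> range (\<lambda>n. - int (Suc n)) = UNIV - {0 :: int}"
  proof (intro equalityI subsetI)
    fix x :: int assume "x \<in> UNIV - {0}"
    then have "x = int (Suc (nat (x - 1))) \<or> x = - int (Suc (nat (- x - 1)))" by auto
    then show "x \<in> range (\<lambda>n. int (Suc n)) \<union> range (\<lambda>n. - int (Suc n))" by blast
  qed auto
  moreover have "(?f has_sum (suminf u + (\<Sum>n. cnj (u n))))
      (range (\<lambda>n. int (Suc n)) \<union> range (\<lambda>n. - int (Suc n)))"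
    by (rule has_sum_Un_disjoint[OF a b]) auto
  moreover have "suminf u + (\<Sum>n. cnj (u n)) = of_real (tail_deriv 0 q \<phi>)"
  proof -
    have "u n + cnj (u n) = complex_of_real (2 * real (Suc n) ^ 0 * q ^ ((Suc n)\<^sup>2)
        * cos (real (Suc n) * \<phi> + real 0 * (pi / 2)))" for n
      by (subst complex_add_cnj) (simp add: u_def)
    then show ?thesis
      unfolding tail_deriv_def
      by (subst suminf_add[OF summable_norm_cancel[OF su] summable_norm_cancel[OF sc]])
        (simp only: suminf_of_real[OF summable_tail_deriv[OF q], symmetric])
  qed
  ultimately show ?thesis by simp
qed

lemma theta_tail_imag:
  "0 < q \<Longrightarrow> q < 1 \<Longrightarrow> theta_tail (\<i> * of_real \<phi>) q = of_real (tail_deriv 0 q \<phi>)"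
  unfolding theta_tail_def by (intro infsumI theta_tail_has_sum)

lemma theta_imag:
  assumes "0 < q" "q < 1"
  shows "theta (\<i> * of_real \<phi>) q = of_real (1 + tail_deriv 0 q \<phi>)"
proof -
  have "((\<lambda>n. of_real (q powi (n\<^sup>2)) * exp (of_int n * (\<i> * of_real \<phi>)))
      has_sum (1 + complex_of_real (tail_deriv 0 q \<phi>))) (insert 0 (UNIV - {0 :: int}))"
    using has_sum_insert[OF _ theta_tail_has_sum[OF assms], of 0 \<phi>] by simp
  then have "((\<lambda>n. of_real (q powi (n\<^sup>2)) * exp (of_int n * (\<i> * of_real \<phi>)))
      has_sum (1 + complex_of_real (tail_deriv 0 q \<phi>))) (UNIV :: int set)"
    by (simp add: insert_Diff_if insert_UNIV)
  then show ?thesis unfolding theta_def by (simp add: infsumI)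
qed

text \<open>
  Completing the square, \<open>-hn\<^sup>2 + n\<alpha> = \<alpha>\<^sup>2/4h - h(\<alpha>/2h - n)\<^sup>2\<close>, exhibits the series as a
  periodized Gaussian, to which the inversion formula applies.
\<close>
lemma theta_real:
  assumes h: "0 < h"
  shows "theta (of_real \<alpha>) (exp (- h)) = of_real (exp (\<alpha>\<^sup>2 / (4 * h)) * periodized_gaussian h (\<alpha> / (2 * h)))"
    and "theta (of_real \<alpha>) (exp (- h))
      = of_real (sqrt (pi / h) * exp (\<alpha>\<^sup>2 / (4 * h))) * theta (\<i> * of_real (pi * \<alpha> / h)) (exp (- pi\<^sup>2 / h))"
proof -
  have t: "complex_of_real (exp (- h) powi (n\<^sup>2)) * exp (of_int n * of_real \<alpha>)
      = of_real (exp (\<alpha>\<^sup>2 / (4 * h))) * of_real (exp (- h * (\<alpha> / (2 * h) + of_int (- n))\<^sup>2))" for n :: int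
  proof -
    have "- (h * of_int (n\<^sup>2)) + of_int n * \<alpha> = \<alpha>\<^sup>2 / (4 * h) + - h * (\<alpha> / (2 * h) + of_int (- n))\<^sup>2"
      using h by (simp add: power2_eq_square field_simps)
    then have "exp (- (h * of_int (n\<^sup>2))) * exp (of_int n * \<alpha>)
        = exp (\<alpha>\<^sup>2 / (4 * h)) * exp (- h * (\<alpha> / (2 * h) + of_int (- n))\<^sup>2)"
      by (simp only: exp_add[symmetric])
    moreover have "exp (of_int n * complex_of_real \<alpha>) = of_real (exp (of_int n * \<alpha>))"
      by (simp flip: exp_of_real)
    ultimately show ?thesis
      by (simp only: exp_power_int of_real_mult[symmetric]) (simp add: mult.commute)
  qed
  have "theta (of_real \<alpha>) (exp (- h)) = of_real (exp (\<alpha>\<^sup>2 / (4 * h)))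
      * (\<Sum>\<^sub>\<infinity>n\<in>(UNIV::int set). complex_of_real (exp (- h * (\<alpha> / (2 * h) + of_int (- n))\<^sup>2)))"
    unfolding theta_def t by (rule infsum_cmult_right')
  also have "(\<Sum>\<^sub>\<infinity>n\<in>(UNIV::int set). complex_of_real (exp (- h * (\<alpha> / (2 * h) + of_int (- n))\<^sup>2)))
      = (\<Sum>\<^sub>\<infinity>n\<in>(UNIV::int set). complex_of_real (exp (- h * (\<alpha> / (2 * h) + of_int n)\<^sup>2)))"
    by (rule infsum_reindex_bij_betw[where g = uminus]) (rule bij_uminus)
  also have "\<dots> = of_real (periodized_gaussian h (\<alpha> / (2 * h)))"
    unfolding periodized_gaussian_def by (rule infsum_complex_of_real)
  finally show 1: "theta (of_real \<alpha>) (exp (- h)) = of_real (exp (\<alpha>\<^sup>2 / (4 * h)) * periodized_gaussian h (\<alpha> / (2 * h)))"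
    by simp
  have "theta (\<i> * of_real (pi * \<alpha> / h)) (exp (- pi\<^sup>2 / h))
      = (\<Sum>\<^sub>\<infinity>n\<in>(UNIV::int set). exp (- pi\<^sup>2 / h * (of_int n)\<^sup>2) * cis (2 * pi * of_int n * (\<alpha> / (2 * h))))"
    unfolding theta_def using h
    by (intro infsum_cong arg_cong2[of _ _ _ _ times])
      (simp_all add: exp_power_int cis_conv_exp field_simps)
  with 1 show "theta (of_real \<alpha>) (exp (- h))
      = of_real (sqrt (pi / h) * exp (\<alpha>\<^sup>2 / (4 * h))) * theta (\<i> * of_real (pi * \<alpha> / h)) (exp (- pi\<^sup>2 / h))"
    by (simp only: of_real_mult jacobi_inversion[OF h]) (simp add: mult_ac)
qed

text \<open>
  For large \<open>h\<close> this cannot be read off the dual series, whose terms have both signs; the inversion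
  formula replaces it by a sum of positive terms.
\<close>
lemma dual_theta_pos:
  assumes h: "0 < h"
  shows "1 + tail_deriv 0 (exp (- pi\<^sup>2 / h)) \<phi> > 0"
proof -
  define \<alpha> where "\<alpha> = h * \<phi> / pi"
  define q where "q = exp (- pi\<^sup>2 / h)"
  have q: "0 < q" "q < 1" using h by (auto simp: q_def)
  have "pi * \<alpha> / h = \<phi>" using h by (simp add: \<alpha>_def)
  then have "of_real (exp (\<alpha>\<^sup>2 / (4 * h)) * periodized_gaussian h (\<alpha> / (2 * h)))
      = of_real (sqrt (pi / h) * exp (\<alpha>\<^sup>2 / (4 * h))) * complex_of_real (1 + tail_deriv 0 q \<phi>)"
    using theta_real[OF h, of \<alpha>, folded q_def] by (simp only: theta_imag[OF q])
  then have eq: "sqrt (pi / h) * exp (\<alpha>\<^sup>2 / (4 * h)) * (1 + tail_deriv 0 q \<phi>)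
      = exp (\<alpha>\<^sup>2 / (4 * h)) * periodized_gaussian h (\<alpha> / (2 * h))"
    by (simp only: of_real_mult[symmetric] of_real_eq_iff)
  have "0 < sqrt (pi / h) * exp (\<alpha>\<^sup>2 / (4 * h)) * (1 + tail_deriv 0 q \<phi>)"
    unfolding eq using periodized_gaussian_pos[OF h] by (intro mult_pos_pos) auto
  then have "0 < 1 + tail_deriv 0 q \<phi>" by (rule zero_less_mult_pos) (use h in simp)
  then show ?thesis by (simp only: q_def)
qed

lemma tail_not_constant:
  assumes q: "0 < q" "q < 1"
  shows "tail_deriv 0 q pi < tail_deriv 0 q 0"
proof -
  let ?t = "\<lambda>\<phi> n. 2 * real (Suc n) ^ 0 * q ^ ((Suc n)\<^sup>2) * cos (real (Suc n) * \<phi> + real 0 * (pi / 2))"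
  have "0 < (\<Sum>n. ?t 0 n - ?t pi n)"
  proof (rule suminf_pos2)
    show "summable (\<lambda>n. ?t 0 n - ?t pi n)" by (intro summable_diff summable_tail_deriv[OF q])
    show "0 \<le> ?t 0 n - ?t pi n" for n
    proof -
      have "2 * q ^ ((Suc n)\<^sup>2) * cos (real (Suc n) * pi) \<le> 2 * q ^ ((Suc n)\<^sup>2) * 1"
        using q by (intro mult_left_mono) auto
      then show ?thesis by simp
    qed
    show "0 < ?t 0 0 - ?t pi 0" using q by simp
  qed
  then show ?thesis
    unfolding tail_deriv_def
    using suminf_diff[OF summable_tail_deriv[OF q, of 0 0] summable_tail_deriv[OF q, of 0 pi]] by linarith
qed

lemma tail_deriv_1_zero: "tail_deriv 1 q 0 = 0"
  by (simp add: tail_deriv_def)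

section \<open>The quantum correction to the form\<close>
lemma frechet_derivative_of_real_Re:
  assumes "\<And>x. (g has_real_derivative g' x) (at x)"
  shows "frechet_derivative (\<lambda>z. complex_of_real (g (Re z))) (at z) = (\<lambda>v. of_real (g' (Re z) * Re v))"
proof -
  have "((\<lambda>z. complex_of_real (g (Re z))) has_derivative (\<lambda>v. of_real (g' (Re z) * Re v))) (at z)"
    by (intro has_derivative_of_real
        has_derivative_compose[OF has_derivative_Re[OF has_derivative_ident]
          assms[unfolded has_field_derivative_def, of "Re z"]])
  then show ?thesis by (rule frechet_derivative_at[symmetric])
qed

lemma d_z_of_real_Re:
  assumes "\<And>x. (g has_real_derivative g' x) (at x)"
  shows "d_z (\<lambda>z. complex_of_real (g (Re z))) = (\<lambda>z. of_real (g' (Re z) / 2))"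
    and "d_zbar (\<lambda>z. complex_of_real (g (Re z))) = (\<lambda>z. of_real (g' (Re z) / 2))"
  by (simp_all add: fun_eq_iff d_z_def d_zbar_def frechet_derivative_of_real_Re[OF assms])

lemma dbar_d_of_real_Re:
  assumes "\<And>x. (g has_real_derivative g' x) (at x)" "\<And>x. (g' has_real_derivative g'' x) (at x)"
  shows "dbar_d (\<lambda>z. complex_of_real (g (Re z))) z a b = of_real (g'' (Re z) / 4) * dzbar_dz a b"
proof -
  have "((\<lambda>x. g' x / 2) has_real_derivative g'' x / 2) (at x)" for x
    using DERIV_cdivide[OF assms(2)] .
  from d_z_of_real_Re(2)[OF this] show ?thesis
    by (simp add: dbar_d_def d_z_of_real_Re(1)[OF assms(1)])
qed

text \<open>
  The first and second derivative of the logarithm of the dual series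
  \<open>1 + tail_deriv 0 q\<close>.
\<close>
definition log_deriv1 :: "real \<Rightarrow> real \<Rightarrow> real" where
  "log_deriv1 q \<phi> = tail_deriv 1 q \<phi> / (1 + tail_deriv 0 q \<phi>)"

definition log_deriv2 :: "real \<Rightarrow> real \<Rightarrow> real" where
  "log_deriv2 q \<phi> = tail_deriv 2 q \<phi> / (1 + tail_deriv 0 q \<phi>) - (log_deriv1 q \<phi>)\<^sup>2"

lemma DERIV_log_dual:
  assumes q: "0 < q" "q < 1" and pos: "\<And>\<phi>. 0 < 1 + tail_deriv 0 q \<phi>"
  shows "((\<lambda>\<phi>. ln (1 + tail_deriv 0 q \<phi>)) has_real_derivative log_deriv1 q \<phi>) (at \<phi>)"
    and "(log_deriv1 q has_real_derivative log_deriv2 q \<phi>) (at \<phi>)"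
proof -
  have d0: "((\<lambda>\<phi>. 1 + tail_deriv 0 q \<phi>) has_real_derivative tail_deriv 1 q \<phi>) (at \<phi>)"
    using DERIV_add[OF DERIV_const DERIV_tail_deriv[OF q, of 0]] by simp
  have d1: "(tail_deriv 1 q has_real_derivative tail_deriv 2 q \<phi>) (at \<phi>)"
    using DERIV_tail_deriv[OF q, of 1 \<phi>] by (simp add: numeral_2_eq_2)
  show "((\<lambda>\<phi>. ln (1 + tail_deriv 0 q \<phi>)) has_real_derivative log_deriv1 q \<phi>) (at \<phi>)"
    using DERIV_chain2[OF DERIV_ln_divide[OF pos] d0] by (simp add: log_deriv1_def)
  have ne: "1 + tail_deriv 0 q \<phi> \<noteq> 0" using pos[of \<phi>] by simp
  show "(log_deriv1 q has_real_derivative log_deriv2 q \<phi>) (at \<phi>)"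
    unfolding log_deriv1_def[abs_def]
    by (rule DERIV_cong[OF DERIV_divide[OF d1 d0 ne]])
      (use ne in \<open>simp add: log_deriv2_def log_deriv1_def diff_divide_distrib power2_eq_square\<close>)
qed

lemma log_deriv_bounds:
  assumes q: "0 < q" "q \<le> 1 / 2" "tail_bound 0 * q \<le> 1 / 2"
  shows "\<bar>log_deriv1 q \<phi>\<bar> \<le> 2 * tail_bound 1 * q"
    and "\<bar>log_deriv2 q \<phi>\<bar> \<le> (2 * tail_bound 2 + 4 * (tail_bound 1)\<^sup>2) * q"
proof -
  have half: "1 / 2 \<le> 1 + tail_deriv 0 q \<phi>"
    using tail_deriv_bound[OF q(1,2), of 0 \<phi>] q(3) by linarith
  have b: "\<bar>tail_deriv j q \<phi> / (1 + tail_deriv 0 q \<phi>)\<bar> \<le> 2 * tail_bound j * q" for j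
  proof -
    have "\<bar>tail_deriv j q \<phi>\<bar> / (1 + tail_deriv 0 q \<phi>) \<le> (tail_bound j * q) / (1 / 2)"
      using half tail_deriv_bound[OF q(1,2)] tail_bound_nonneg[of j] q(1) by (intro frac_le) auto
    then show ?thesis using half by (simp add: abs_divide)
  qed
  show 1: "\<bar>log_deriv1 q \<phi>\<bar> \<le> 2 * tail_bound 1 * q" unfolding log_deriv1_def by (rule b)
  have "(log_deriv1 q \<phi>)\<^sup>2 \<le> (2 * tail_bound 1 * q)\<^sup>2"
    using 1 by (metis abs_ge_zero power2_abs power_mono)
  also have "\<dots> = 4 * (tail_bound 1)\<^sup>2 * (q * q)" by (simp add: power2_eq_square)
  also have "\<dots> \<le> 4 * (tail_bound 1)\<^sup>2 * q"
    using q by (intro mult_left_mono) (auto simp: mult_le_one mult_left_le)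
  finally show "\<bar>log_deriv2 q \<phi>\<bar> \<le> (2 * tail_bound 2 + 4 * (tail_bound 1)\<^sup>2) * q"
    using b[of 2] zero_le_power2[of "log_deriv1 q \<phi>"] unfolding log_deriv2_def distrib_right by linarith
qed

text \<open>
  Otherwise the logarithmic derivative is a constant; it vanishes at \<open>0\<close> by parity, so the series
  would be constant.
\<close>
lemma log_deriv2_not_zero:
  assumes q: "0 < q" "q < 1" and pos: "\<And>\<phi>. 0 < 1 + tail_deriv 0 q \<phi>"
  shows "\<exists>\<phi>. log_deriv2 q \<phi> \<noteq> 0"
proof (rule ccontr)
  assume "\<not> ?thesis"
  then have "(log_deriv1 q has_real_derivative 0) (at \<phi>)" for \<phi>
    using DERIV_log_dual(2)[OF assms, of \<phi>] by simp
  then have "log_deriv1 q \<phi> = log_deriv1 q 0" for \<phi> by (intro DERIV_isconst_all) blast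
  then have "log_deriv1 q \<phi> = 0" for \<phi>
    by (metis log_deriv1_def tail_deriv_1_zero div_0)
  then have "tail_deriv 1 q \<phi> = 0" for \<phi>
    using pos[of \<phi>] unfolding log_deriv1_def by (metis divide_eq_0_iff less_irrefl)
  then have "(tail_deriv 0 q has_real_derivative 0) (at \<phi>)" for \<phi>
    using DERIV_tail_deriv[OF q, of 0 \<phi>] by simp
  then have "tail_deriv 0 q pi = tail_deriv 0 q 0" by (intro DERIV_isconst_all) blast
  with tail_not_constant[OF q] show False by simp
qed

lemma cnj_add_eq: "cnj z + z - of_real h = of_real (2 * Re z - h)"
  by (simp add: complex_eq_iff)

text \<open>
  The argument of the dual series is \<open>\<i>\<close> times this phase.
\<close>
definition dual_phase :: "real \<Rightarrow> complex \<Rightarrow> real" where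
  "dual_phase h z = pi * (2 * Re z - h) / h"

lemma dual_phase_eq:
  "\<i> * pi * (cnj z + z - of_real h) / h = \<i> * of_real (dual_phase h z)"
  "\<i> * pi / h * (cnj z + z - of_real h) = \<i> * of_real (dual_phase h z)"
  unfolding cnj_add_eq dual_phase_def by simp_all

lemma ln_of_real_exp: "ln (complex_of_real (exp x)) = of_real x"
  by (subst Ln_of_real) auto

text \<open>
  For a function of \<open>x = Re z\<close> the operator is a quarter of the second derivative. The phase has slope
  \<open>2\<pi>/h\<close>, whence the factor \<open>\<pi>\<^sup>2/h\<close>; the exponent \<open>(2x - h)\<^sup>2/4h\<close> of the Gaussian
  factor has second derivative \<open>2/h\<close>, which is the term \<open>\<i>/2\<close>.
\<close>
lemma dbar_d_log_dual:
  assumes h: "0 < h" and q: "q = exp (- pi\<^sup>2 / h)"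
  shows "\<i> * of_real h * dbar_d (\<lambda>z. ln (theta (\<i> * pi * (cnj z + z - of_real h) / h) q)) z a b
    = \<i> * of_real (pi\<^sup>2 / h * log_deriv2 q (dual_phase h z)) * dzbar_dz a b"
    and "\<i> * of_real h * dbar_d (\<lambda>z. ln (theta (cnj z + z - of_real h) (exp (- h)))) z a b
    = \<i> / 2 * dzbar_dz a b + \<i> * of_real (pi\<^sup>2 / h * log_deriv2 q (dual_phase h z)) * dzbar_dz a b"
proof -
  have q01: "0 < q" "q < 1" using h by (auto simp: q)
  have pos: "0 < 1 + tail_deriv 0 q \<phi>" for \<phi> using dual_theta_pos[OF h] by (simp add: q)
  define L where "L x = ln (1 + tail_deriv 0 q (pi * (2 * x - h) / h))" for x
  define L1 where "L1 x = 2 * pi / h * log_deriv1 q (pi * (2 * x - h) / h)" for x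
  define L2 where "L2 x = (2 * pi / h) * (2 * pi / h) * log_deriv2 q (pi * (2 * x - h) / h)" for x
  have lin: "((\<lambda>x. pi * (2 * x - h) / h) has_real_derivative 2 * pi / h) (at x)" for x
    using h by (auto intro!: derivative_eq_intros)
  have dL: "(L has_real_derivative L1 x) (at x)" for x
    using DERIV_chain2[OF DERIV_log_dual(1)[OF q01 pos] lin]
    by (simp add: L_def[abs_def] L1_def mult_ac)
  have dL1: "(L1 has_real_derivative L2 x) (at x)" for x
    using DERIV_cmult[OF DERIV_chain2[OF DERIV_log_dual(2)[OF q01 pos] lin], of "2 * pi / h"]
    by (simp add: L1_def[abs_def] L2_def mult_ac)
  have "(\<lambda>z. ln (theta (\<i> * pi * (cnj z + z - of_real h) / h) q)) = (\<lambda>z. of_real (L (Re z)))"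
    unfolding dual_phase_eq theta_imag[OF q01] L_def dual_phase_def by (subst Ln_of_real[OF pos]) simp
  then show "\<i> * of_real h * dbar_d (\<lambda>z. ln (theta (\<i> * pi * (cnj z + z - of_real h) / h) q)) z a b
    = \<i> * of_real (pi\<^sup>2 / h * log_deriv2 q (dual_phase h z)) * dzbar_dz a b"
    using h by (simp add: dbar_d_of_real_Re[OF dL dL1]) (simp add: L2_def dual_phase_def field_simps power2_eq_square)
  define G where "G x = ln (sqrt (pi / h)) + (2 * x - h)\<^sup>2 / (4 * h) + L x" for x
  define G1 where "G1 x = (2 * x - h) / h + L1 x" for x
  have dG: "(G has_real_derivative G1 x) (at x)" for x
    unfolding G_def[abs_def] G1_def
    using h by (auto intro!: derivative_eq_intros dL simp: field_simps)
  have dG1: "(G1 has_real_derivative 2 / h + L2 x) (at x)" for x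
    unfolding G1_def[abs_def]
    using h by (auto intro!: derivative_eq_intros dL1 simp: field_simps)
  have "ln (theta (cnj z + z - of_real h) (exp (- h))) = of_real (G (Re z))" for z
  proof -
    have "theta (cnj z + z - of_real h) (exp (- h)) = of_real (exp (G (Re z)))"
      unfolding cnj_add_eq theta_real(2)[OF h, folded q] theta_imag[OF q01] G_def L_def
      using h pos[of "pi * (2 * Re z - h) / h"] by (simp add: exp_add)
    then show ?thesis by (simp only: ln_of_real_exp)
  qed
  then have "(\<lambda>z. ln (theta (cnj z + z - of_real h) (exp (- h)))) = (\<lambda>z. of_real (G (Re z)))" by simp
  then show "\<i> * of_real h * dbar_d (\<lambda>z. ln (theta (cnj z + z - of_real h) (exp (- h)))) z a b
    = \<i> / 2 * dzbar_dz a b + \<i> * of_real (pi\<^sup>2 / h * log_deriv2 q (dual_phase h z)) * dzbar_dz a b"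
    using h by (simp add: dbar_d_of_real_Re[OF dG dG1]) (simp add: L2_def dual_phase_def field_simps power2_eq_square)
qed

section \<open>Integrals and densities on the plane\<close>
lemma lborel_complex_eq: "(lborel :: complex measure) = distr (lborel \<Otimes>\<^sub>M lborel) borel (\<lambda>(x, y). Complex x y)"
proof (rule lborel_eqI)
  have m: "(\<lambda>(x, y). Complex x y) \<in> borel_measurable (lborel \<Otimes>\<^sub>M lborel)"
    unfolding Complex_eq case_prod_beta by measurable
  fix l u :: complex assume le: "\<And>b. b \<in> Basis \<Longrightarrow> l \<bullet> b \<le> u \<bullet> b"
  have le': "Re l \<le> Re u" "Im l \<le> Im u"
    using le[of 1] le[of \<i>] by (simp_all add: Basis_complex_def)
  have "emeasure (distr (lborel \<Otimes>\<^sub>M lborel) borel (\<lambda>(x, y). Complex x y)) (box l u)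
      = emeasure (lborel \<Otimes>\<^sub>M lborel) ({Re l<..<Re u} \<times> {Im l<..<Im u})"
    by (subst emeasure_distr[OF m])
      (auto intro!: arg_cong[of _ _ "emeasure (lborel \<Otimes>\<^sub>M lborel)"] simp: box_def Basis_complex_def space_pair_measure)
  also have "\<dots> = ennreal (Re u - Re l) * ennreal (Im u - Im l)"
    using le' by (subst lborel.emeasure_pair_measure_Times) auto
  also have "\<dots> = (\<Prod>b\<in>Basis. (u - l) \<bullet> b)"
    using le' by (simp add: Basis_complex_def ennreal_mult)
  finally show "emeasure (distr (lborel \<Otimes>\<^sub>M lborel) borel (\<lambda>(x, y). Complex x y)) (box l u)
      = (\<Prod>b\<in>Basis. (u - l) \<bullet> b)" .
qed simp

lemma integral_box_Re:
  fixes k :: "real \<Rightarrow> complex"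
  assumes k: "continuous_on UNIV k" and le: "Im p \<le> Im q"
  shows "(LINT z:cbox p q|lborel. k (Re z)) = of_real (Im q - Im p) * integral {Re p..Re q} k"
proof -
  let ?f = "\<lambda>z. k (Re z)"
  have m: "(\<lambda>(x, y). Complex x y) \<in> borel_measurable (lborel \<Otimes>\<^sub>M lborel)"
    unfolding Complex_eq case_prod_beta by measurable
  have kb[measurable]: "k \<in> borel_measurable borel" by (rule borel_measurable_continuous_onI[OF k])
  have cont: "continuous_on S (\<lambda>x. k (fst x))" for S :: "(real \<times> real) set"
    by (rule continuous_on_compose2[OF k]) (auto intro!: continuous_intros)
  have "(LINT z:cbox p q|lborel. ?f z)
      = (LINT w|(lborel \<Otimes>\<^sub>M lborel). indicator (cbox p q) (case w of (x, y) \<Rightarrow> Complex x y) *\<^sub>R ?f (case w of (x, y) \<Rightarrow> Complex x y))"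
    unfolding set_lebesgue_integral_def
    by (subst lborel_complex_eq, subst integral_distr[OF m]) (auto intro!: borel_measurable_scaleR)
  also have "\<dots> = (LINT w:cbox (Re p, Im p) (Re q, Im q)|lborel. k (fst w))"
    unfolding set_lebesgue_integral_def lborel_prod
    by (intro Bochner_Integration.integral_cong refl) (auto simp: indicator_def in_cbox_complex_iff)
  also have "\<dots> = integral (cbox (Re p, Im p) (Re q, Im q)) (\<lambda>w. k (fst w))"
    by (rule set_borel_integral_eq_integral(2))
      (auto simp: set_integrable_def intro!: borel_integrable_compact cont)
  also have "\<dots> = integral (cbox (Re p) (Re q)) (\<lambda>x. integral (cbox (Im p) (Im q)) (\<lambda>y. k x))"
    by (subst integral_prod_continuous) (auto intro!: cont)
  also have "\<dots> = of_real (Im q - Im p) * integral {Re p..Re q} k"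
    using le by (simp add: scaleR_conv_of_real)
  finally show ?thesis .
qed

lemma continuous_log_deriv2:
  assumes q: "0 < q" "q < 1" and pos: "\<And>\<phi>. 0 < 1 + tail_deriv 0 q \<phi>"
  shows "continuous_on UNIV (log_deriv2 q)"
proof -
  have c: "continuous_on UNIV (tail_deriv j q)" for j
    using DERIV_continuous[OF DERIV_tail_deriv[OF q]] by (simp add: continuous_on_eq_continuous_at)
  have "1 + tail_deriv 0 q \<phi> \<noteq> 0" for \<phi> using pos[of \<phi>] by simp
  then show ?thesis
    unfolding log_deriv2_def[abs_def] log_deriv1_def by (intro continuous_intros c) auto
qed

lemma measure_density_near:
  fixes f :: "complex \<Rightarrow> real"
  assumes f[measurable]: "f \<in> borel_measurable borel" and S[measurable]: "S \<in> sets borel" "bounded S"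
    and e: "\<And>z. \<bar>f z\<bar> \<le> e" "e \<le> 1"
  shows "\<bar>measure (density lborel (\<lambda>z. ennreal (1 + f z))) S - measure lborel S\<bar> \<le> e * measure lborel S"
proof -
  let ?m = "measure lborel S" and ?D = "density lborel (\<lambda>z. ennreal (1 + f z))"
  have e0: "0 \<le> e" using e(1)[of 0] by linarith
  have m: "emeasure lborel S = ennreal ?m"
    using emeasure_bounded_finite[OF S(2)] by (intro emeasure_eq_ennreal_measure) auto
  have D: "emeasure ?D S = (\<integral>\<^sup>+z. ennreal (1 + f z) * indicator S z \<partial>lborel)"
    by (subst emeasure_density) auto
  have c: "(\<integral>\<^sup>+z. ennreal r * indicator S z \<partial>lborel) = ennreal (r * ?m)" if "0 \<le> r" for r
    using that by (simp add: nn_integral_cmult_indicator m ennreal_mult)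
  have up: "emeasure ?D S \<le> ennreal ((1 + e) * ?m)"
    unfolding D c[symmetric, of "1 + e", OF add_nonneg_nonneg[OF zero_le_one e0]]
    using e(1) by (intro nn_integral_mono mult_right_mono ennreal_leI) (auto simp: abs_le_iff)
  have lo: "ennreal ((1 - e) * ?m) \<le> emeasure ?D S"
  proof -
    have "1 - e \<le> 1 + f z" for z using e(1)[of z] by linarith
    then have "(\<integral>\<^sup>+z. ennreal (1 - e) * indicator S z \<partial>lborel) \<le> emeasure ?D S"
      unfolding D by (intro nn_integral_mono mult_right_mono ennreal_leI) auto
    then show ?thesis using c[of "1 - e"] e(2) by simp
  qed
  have fin: "emeasure ?D S = ennreal (measure ?D S)"
    using up by (intro emeasure_eq_ennreal_measure) (auto simp: top_unique)
  have "measure ?D S \<le> (1 + e) * ?m" "(1 - e) * ?m \<le> measure ?D S"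
    using up lo e0 unfolding fin by (simp_all add: ennreal_le_iff mult_nonneg_nonneg)
  then show ?thesis by (simp add: abs_le_iff algebra_simps)
qed

text \<open>
  The densities agree almost everywhere, and the set where two continuous functions differ is open;
  an open null set is empty.
\<close>
lemma density_lborel_eq_imp:
  fixes f :: "complex \<Rightarrow> real"
  assumes f: "continuous_on UNIV f" "\<And>z. 0 < 1 + f z"
    and eq: "density lborel (\<lambda>z. ennreal (1 + f z)) = lborel"
  shows "f z = 0"
proof (rule ccontr)
  have [measurable]: "f \<in> borel_measurable borel" by (rule borel_measurable_continuous_onI[OF f(1)])
  assume "f z \<noteq> 0"
  then have ne: "{z. f z \<noteq> 0} \<noteq> {}" by auto
  have "density lborel (\<lambda>z. ennreal (1 + f z)) = density lborel (\<lambda>z. 1)"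
    using eq by (simp add: density_1)
  then have "AE z in lborel. ennreal (1 + f z) = 1"
    by (subst (asm) sigma_finite_measure.density_unique_iff[OF sigma_finite_lborel]) auto
  then have "AE z in lborel. \<not> f z \<noteq> 0"
  proof eventually_elim
    case (elim z)
    then show ?case using f(2)[of z] by (simp add: ennreal_eq_1)
  qed
  then have ae: "AE z in lborel. z \<notin> {z. f z \<noteq> 0}" by simp
  have op: "open {z. f z \<noteq> 0}"
    by (intro open_Collect_neq continuous_intros f(1))
  then have "{z. f z \<noteq> 0} \<in> null_sets lborel"
    using ae by (subst AE_iff_null_sets) auto
  then have "negligible {z. f z \<noteq> 0}"
    by (simp add: negligible_iff_null_sets null_sets_completionI)
  with op ne show False using open_not_negligible by blast
qed

lemma continuous_dual_phase: "continuous_on UNIV (dual_phase h)"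
  unfolding dual_phase_def[abs_def] by (cases "h = 0") (auto intro!: continuous_intros)

section \<open>The quantum form and the reproducing measure\<close>
theorem mainTheorem15:
  fixes v :: "real^'k::finite \<Rightarrow> real^'k"
    and \<rho> g :: "real^'k \<Rightarrow> real"
    and \<kappa> :: "nat \<Rightarrow> real^'k \<Rightarrow> real"
    and \<gamma> :: "real \<Rightarrow> real^'k \<Rightarrow> real^'k"
    and K :: real
    and a0 :: "real^'k"
    and M :: "real^'k \<Rightarrow> complex"
    and X :: "((real^'k) \<times> complex) set"
    and Ker :: "real \<Rightarrow> complex \<Rightarrow> complex \<Rightarrow> complex"
    and \<omega> :: "real \<Rightarrow> two_form"
    and \<omega>0 :: two_form
    and dm :: "real \<Rightarrow> complex measure"
    and dm0 :: "complex measure"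
  assumes leaf: "cylindrical_leaf v \<rho> \<kappa> \<gamma> K a0 g M X"
    and omega0: "\<omega>0 = classical_form v \<rho> \<gamma> a0 M X"
    and liouville: "dm0 = form_measure \<omega>0"
    and kernel: "\<And>h w z. 0 < h \<Longrightarrow> Ker h w z = theta (cnj w + z - of_real h) (exp (- h))"
    and reproducing: "\<And>h. 0 < h \<Longrightarrow> reproducing_measure h (Ker h) (\<omega> h) (dm h)"
    and density: "\<And>h. 0 < h \<Longrightarrow> dm h = form_measure (\<lambda>z a b.
          1/2 * theta (\<i> * pi / h * (cnj z + z - of_real h)) (exp (- pi\<^sup>2 / h)) * dzbar_dz a b)"
  shows "(\<omega>0 = (\<lambda>z a b. \<i>/2 * dzbar_dz a b)) \<and>
    (dm0 = form_measure (\<lambda>z a b. 1/2 * dzbar_dz a b)) \<and>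
    (\<forall>h>0. \<omega> h = (\<lambda>z a b. \<omega>0 z a b
        + \<i> * of_real h * dbar_d (\<lambda>z. ln (theta (\<i> * pi * (cnj z + z - of_real h) / h) (exp (- pi\<^sup>2 / h)))) z a b)) \<and>
    (\<forall>h>0. \<omega> h \<noteq> \<omega>0) \<and>
    (\<exists>c. \<forall>\<^sub>F h in at_right 0. \<forall>z a b.
        cmod (\<omega> h z a b - \<omega>0 z a b) \<le> c * (exp (- pi\<^sup>2 / h) / h) * (cmod a * cmod b)) \<and>
    (\<exists>c. \<forall>\<^sub>F h in at_right 0. \<forall>p q. Re p \<le> Re q \<longrightarrow> Im p \<le> Im q \<longrightarrow>
        cmod (LINT z:cbox p q|lborel. \<omega> h z 1 \<i> - \<omega>0 z 1 \<i>) \<le> c * exp (- pi\<^sup>2 / h) * (Im q - Im p)) \<and>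
    (\<forall>h>0. dm h = density dm0 (\<lambda>z. ennreal (1 +
        Re (theta_tail (\<i> * pi / h * (cnj z + z - of_real h)) (exp (- pi\<^sup>2 / h)))))) \<and>
    (\<forall>h>0. dm h \<noteq> dm0) \<and>
    (\<exists>c. \<forall>\<^sub>F h in at_right 0. \<forall>z.
        cmod (theta_tail (\<i> * pi / h * (cnj z + z - of_real h)) (exp (- pi\<^sup>2 / h))) \<le> c * exp (- pi\<^sup>2 / h)) \<and>
    (\<exists>c. \<forall>\<^sub>F h in at_right 0. \<forall>S\<in>sets borel. bounded S \<longrightarrow>
        \<bar>measure (dm h) S - measure dm0 S\<bar>
          \<le> c * exp (- pi\<^sup>2 / h) * measure dm0 S)"
proof -
  define Q where "Q h = exp (- pi\<^sup>2 / h)" for h :: real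
  have Q: "0 < Q h" "Q h < 1" if "0 < h" for h using that by (auto simp: Q_def)
  have pos: "0 < 1 + tail_deriv 0 (Q h) \<phi>" if "0 < h" for h \<phi>
    using dual_theta_pos[OF that] by (simp add: Q_def)
  have dz: "dzbar_dz 1 \<i> = 2 * \<i>" by (simp add: dzbar_dz_def)
  have phase_onto: "\<exists>z. dual_phase h z = \<phi>" if "0 < h" for h \<phi>
    using that by (intro exI[of _ "of_real ((h * \<phi> / pi + h) / 2)"]) (simp add: dual_phase_def field_simps)

  have w0: "\<omega>0 = (\<lambda>z a b. \<i>/2 * dzbar_dz a b)"
    unfolding omega0 by (rule cylindrical_leaf.classical_form_eq[OF leaf])
  have lebesgue: "form_measure (\<lambda>z a b. 1/2 * dzbar_dz a b) = lborel"
    by (simp add: form_measure_def dz norm_mult density_1)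
  have m0: "dm0 = lborel"
    by (simp add: liouville w0 form_measure_def dz norm_mult density_1)
  have w: "\<omega> h z a b = \<omega>0 z a b + \<i> * of_real (pi\<^sup>2 / h * log_deriv2 (Q h) (dual_phase h z)) * dzbar_dz a b"
    if "0 < h" for h z a b
  proof -
    have "\<omega> h = kahler_form h (Ker h)" using reproducing[OF that] by (simp add: reproducing_measure_def)
    then show ?thesis
      using dbar_d_log_dual(2)[OF that Q_def] by (simp add: kahler_form_def kernel[OF that] w0)
  qed
  have m: "dm h = density lborel (\<lambda>z. ennreal (1 + tail_deriv 0 (Q h) (dual_phase h z)))" if "0 < h" for h
  proof -
    have "cmod (1/2 * theta (\<i> * pi / h * (cnj z + z - of_real h)) (exp (- pi\<^sup>2 / h)) * dzbar_dz 1 \<i>)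
        = 1 + tail_deriv 0 (Q h) (dual_phase h z)" for z
      unfolding dual_phase_eq Q_def[symmetric] theta_imag[OF Q[OF that]] dz
      using pos[OF that, of "dual_phase h z"] by (simp only: norm_mult norm_of_real) simp
    then show ?thesis unfolding density[OF that] form_measure_def by (simp only:)
  qed
  have tail: "theta_tail (\<i> * pi / h * (cnj z + z - of_real h)) (exp (- pi\<^sup>2 / h))
      = of_real (tail_deriv 0 (Q h) (dual_phase h z))" if "0 < h" for h z
    unfolding dual_phase_eq Q_def[symmetric] by (rule theta_tail_imag[OF Q[OF that]])

  have "(Q \<longlongrightarrow> 0) (at_right 0)" unfolding Q_def[abs_def] by real_asymp
  then have lim: "\<forall>\<^sub>F h in at_right 0. Q h < x" if "0 < x" for x using that by (rule order_tendstoD)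
  have "\<forall>\<^sub>F h in at_right 0. Q h < 1 / 2" "\<forall>\<^sub>F h in at_right 0. Q h < 1 / (2 * (tail_bound 0 + 1))"
    using tail_bound_nonneg[of 0] by (intro lim; simp)+
  moreover have "\<forall>\<^sub>F h in at_right 0. (0::real) < h" by (rule eventually_at_right_less)
  ultimately have small: "\<forall>\<^sub>F h in at_right 0. 0 < h \<and> Q h \<le> 1 / 2 \<and> tail_bound 0 * Q h \<le> 1 / 2"
  proof eventually_elim
    case (elim h)
    have "tail_bound 0 * Q h \<le> (tail_bound 0 + 1) * (1 / (2 * (tail_bound 0 + 1)))"
      using elim tail_bound_nonneg[of 0] Q(1)[of h] by (intro mult_mono) auto
    also have "\<dots> = 1 / 2" using tail_bound_nonneg[of 0] by simp
    finally show ?case using elim by simp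
  qed

  have forms_differ: "\<omega> h \<noteq> \<omega>0" if h: "0 < h" for h
  proof
    assume eq: "\<omega> h = \<omega>0"
    obtain z where "log_deriv2 (Q h) (dual_phase h z) \<noteq> 0"
      using log_deriv2_not_zero[OF Q[OF h] pos[OF h]] phase_onto[OF h] by metis
    with w[OF h, of z 1 \<i>] show False using h by (simp add: eq dz)
  qed
  have form_bound: "\<exists>c. \<forall>\<^sub>F h in at_right 0. \<forall>z a b.
      cmod (\<omega> h z a b - \<omega>0 z a b) \<le> c * (exp (- pi\<^sup>2 / h) / h) * (cmod a * cmod b)"
  proof (intro exI)
    let ?B = "2 * tail_bound 2 + 4 * (tail_bound 1)\<^sup>2"
    show "\<forall>\<^sub>F h in at_right 0. \<forall>z a b. cmod (\<omega> h z a b - \<omega>0 z a b)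
        \<le> (2 * pi\<^sup>2 * ?B) * (exp (- pi\<^sup>2 / h) / h) * (cmod a * cmod b)"
      using small
    proof (eventually_elim, intro allI)
      fix h z a b assume h: "0 < h \<and> Q h \<le> 1 / 2 \<and> tail_bound 0 * Q h \<le> 1 / 2"
      have "cmod (dzbar_dz a b) \<le> 2 * (cmod a * cmod b)"
        unfolding dzbar_dz_def using norm_triangle_ineq4[of "cnj a * b" "cnj b * a"] by (simp add: norm_mult mult_ac)
      moreover have "\<bar>log_deriv2 (Q h) (dual_phase h z)\<bar> \<le> ?B * Q h"
        using h Q(1)[of h] by (intro log_deriv_bounds) auto
      ultimately have "\<bar>pi\<^sup>2 / h\<bar> * \<bar>log_deriv2 (Q h) (dual_phase h z)\<bar> * cmod (dzbar_dz a b)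
          \<le> pi\<^sup>2 / h * (?B * Q h) * (2 * (cmod a * cmod b))"
        using h Q(1)[of h] tail_bound_nonneg[of 2] by (intro mult_mono mult_nonneg_nonneg) auto
      moreover have "cmod (\<omega> h z a b - \<omega>0 z a b)
          = \<bar>pi\<^sup>2 / h\<bar> * \<bar>log_deriv2 (Q h) (dual_phase h z)\<bar> * cmod (dzbar_dz a b)"
        using h w[of h z a b] by (simp add: norm_mult norm_divide norm_power abs_mult)
      ultimately show "cmod (\<omega> h z a b - \<omega>0 z a b)
          \<le> (2 * pi\<^sup>2 * ?B) * (exp (- pi\<^sup>2 / h) / h) * (cmod a * cmod b)"
        by (simp add: Q_def mult_ac)
    qed
  qed
  have box_bound: "\<exists>c. \<forall>\<^sub>F h in at_right 0. \<forall>p q. Re p \<le> Re q \<longrightarrow> Im p \<le> Im q \<longrightarrow>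
      cmod (LINT z:cbox p q|lborel. \<omega> h z 1 \<i> - \<omega>0 z 1 \<i>) \<le> c * exp (- pi\<^sup>2 / h) * (Im q - Im p)"
  proof (intro exI)
    show "\<forall>\<^sub>F h in at_right 0. \<forall>p q. Re p \<le> Re q \<longrightarrow> Im p \<le> Im q \<longrightarrow>
      cmod (LINT z:cbox p q|lborel. \<omega> h z 1 \<i> - \<omega>0 z 1 \<i>) \<le> (4 * pi * tail_bound 1) * exp (- pi\<^sup>2 / h) * (Im q - Im p)"
      using small
    proof (eventually_elim, intro allI impI)
      fix h :: real and p q :: complex
      assume h: "0 < h \<and> Q h \<le> 1 / 2 \<and> tail_bound 0 * Q h \<le> 1 / 2" and le: "Re p \<le> Re q" "Im p \<le> Im q"
      then have h0: "0 < h" by simp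
      define k where "k x = complex_of_real (- 2 * pi\<^sup>2 / h * log_deriv2 (Q h) (pi * (2 * x - h) / h))" for x
      \<comment> \<open>An antiderivative of \<open>k\<close>: one factor \<open>2\<pi>/h\<close> is absorbed by the slope of the phase.\<close>
      define H where "H x = - pi * log_deriv1 (Q h) (pi * (2 * x - h) / h)" for x
      have kcont: "continuous_on UNIV k"
        unfolding k_def[abs_def] using h0
        by (intro continuous_intros continuous_on_compose2[OF continuous_log_deriv2[OF Q[OF h0] pos[OF h0]]]) auto
      have diff: "\<omega> h z 1 \<i> - \<omega>0 z 1 \<i> = k (Re z)" for z
        unfolding w[OF h0] dz k_def dual_phase_def by (simp add: mult_ac)
      have "((\<lambda>x. complex_of_real (H x)) has_vector_derivative k x) (at x within {Re p..Re q})" for x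
      proof -
        have "((\<lambda>x. pi * (2 * x - h) / h) has_real_derivative 2 * pi / h) (at x)"
          using h0 by (auto intro!: derivative_eq_intros)
        from DERIV_cmult[OF DERIV_chain2[OF DERIV_log_dual(2)[OF Q[OF h0] pos[OF h0]] this], of "- pi"]
        have "(H has_real_derivative - 2 * pi\<^sup>2 / h * log_deriv2 (Q h) (pi * (2 * x - h) / h)) (at x)"
          by (simp add: H_def[abs_def] power2_eq_square mult_ac)
        then have "((\<lambda>x. complex_of_real (H x)) has_vector_derivative k x) (at x)"
          unfolding k_def by (rule has_vector_derivative_of_real)
        then show ?thesis by (rule has_vector_derivative_at_within)
      qed
      then have "(k has_integral (of_real (H (Re q)) - of_real (H (Re p)))) {Re p..Re q}"
        by (intro fundamental_theorem_of_calculus le)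
      then have "(LINT z:cbox p q|lborel. \<omega> h z 1 \<i> - \<omega>0 z 1 \<i>) = of_real ((Im q - Im p) * (H (Re q) - H (Re p)))"
        unfolding diff integral_box_Re[OF kcont le(2)] by (simp add: integral_unique)
      then have "cmod (LINT z:cbox p q|lborel. \<omega> h z 1 \<i> - \<omega>0 z 1 \<i>) = (Im q - Im p) * \<bar>H (Re q) - H (Re p)\<bar>"
        using le by (simp add: norm_mult flip: of_real_diff)
      also have "\<dots> \<le> (Im q - Im p) * (4 * pi * tail_bound 1 * Q h)"
      proof (intro mult_left_mono)
        have "\<bar>H x\<bar> \<le> pi * (2 * tail_bound 1 * Q h)" for x
        proof -
          have "\<bar>log_deriv1 (Q h) (pi * (2 * x - h) / h)\<bar> \<le> 2 * tail_bound 1 * Q h"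
            using h Q(1)[of h] by (intro log_deriv_bounds) auto
          then show ?thesis unfolding H_def abs_mult by simp
        qed
        from this[of "Re q"] this[of "Re p"] show "\<bar>H (Re q) - H (Re p)\<bar> \<le> 4 * pi * tail_bound 1 * Q h"
          by (simp add: abs_le_iff)
      qed (use le in simp)
      finally show "cmod (LINT z:cbox p q|lborel. \<omega> h z 1 \<i> - \<omega>0 z 1 \<i>)
          \<le> (4 * pi * tail_bound 1) * exp (- pi\<^sup>2 / h) * (Im q - Im p)"
        by (simp add: Q_def mult_ac)
    qed
  qed
  have tail_cont: "continuous_on UNIV (\<lambda>z. tail_deriv 0 (Q h) (dual_phase h z))" if "0 < h" for h
    using DERIV_continuous[OF DERIV_tail_deriv[OF Q[OF that]]]
    by (intro continuous_on_compose2[OF _ continuous_dual_phase, of UNIV]) (auto simp: continuous_on_eq_continuous_at)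
  have measures_differ: "dm h \<noteq> dm0" if "0 < h" for h
  proof
    assume "dm h = dm0"
    then have "tail_deriv 0 (Q h) (dual_phase h z) = 0" for z
      unfolding m[OF that] m0 by (rule density_lborel_eq_imp[OF tail_cont[OF that] pos[OF that]])
    then have "tail_deriv 0 (Q h) \<phi> = 0" for \<phi> using phase_onto[OF that, of \<phi>] by metis
    then show False using tail_not_constant[OF Q[OF that]] by simp
  qed
  have tail_small: "\<exists>c. \<forall>\<^sub>F h in at_right 0. \<forall>z.
      cmod (theta_tail (\<i> * pi / h * (cnj z + z - of_real h)) (exp (- pi\<^sup>2 / h))) \<le> c * exp (- pi\<^sup>2 / h)"
  proof (intro exI)
    show "\<forall>\<^sub>F h in at_right 0. \<forall>z.
      cmod (theta_tail (\<i> * pi / h * (cnj z + z - of_real h)) (exp (- pi\<^sup>2 / h))) \<le> tail_bound 0 * exp (- pi\<^sup>2 / h)"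
      using small
    proof (eventually_elim, intro allI)
      fix h z assume h: "0 < h \<and> Q h \<le> 1 / 2 \<and> tail_bound 0 * Q h \<le> 1 / 2"
      then show "cmod (theta_tail (\<i> * pi / h * (cnj z + z - of_real h)) (exp (- pi\<^sup>2 / h))) \<le> tail_bound 0 * exp (- pi\<^sup>2 / h)"
        using tail_deriv_bound[of "Q h" 0 "dual_phase h z"] Q(1)[of h] by (subst tail) (auto simp: Q_def)
    qed
  qed
  have measure_bound: "\<exists>c. \<forall>\<^sub>F h in at_right 0. \<forall>S\<in>sets borel. bounded S \<longrightarrow>
      \<bar>measure (dm h) S - measure dm0 S\<bar> \<le> c * exp (- pi\<^sup>2 / h) * measure dm0 S"
  proof (intro exI)
    show "\<forall>\<^sub>F h in at_right 0. \<forall>S\<in>sets borel. bounded S \<longrightarrow>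
      \<bar>measure (dm h) S - measure dm0 S\<bar> \<le> tail_bound 0 * exp (- pi\<^sup>2 / h) * measure dm0 S"
      using small
    proof (eventually_elim, intro ballI impI)
      fix h :: real and S :: "complex set"
      assume h: "0 < h \<and> Q h \<le> 1 / 2 \<and> tail_bound 0 * Q h \<le> 1 / 2" and S: "S \<in> sets borel" "bounded S"
      have b: "\<bar>tail_deriv 0 (Q h) (dual_phase h z)\<bar> \<le> tail_bound 0 * Q h" for z
        using h Q(1)[of h] by (intro tail_deriv_bound) auto
      have "\<bar>measure (dm h) S - measure lborel S\<bar> \<le> (tail_bound 0 * Q h) * measure lborel S"
        unfolding m[OF conjunct1[OF h]] using h
        by (intro measure_density_near borel_measurable_continuous_onI tail_cont S b) auto
      then show "\<bar>measure (dm h) S - measure dm0 S\<bar> \<le> tail_bound 0 * exp (- pi\<^sup>2 / h) * measure dm0 S"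
        by (simp add: m0 Q_def)
    qed
  qed
  show ?thesis
  proof (intro conjI allI impI)
    show "dm0 = form_measure (\<lambda>z a b. 1/2 * dzbar_dz a b)" unfolding lebesgue m0 ..
  next
    fix h :: real assume h: "0 < h"
    show "\<omega> h = (\<lambda>z a b. \<omega>0 z a b
        + \<i> * of_real h * dbar_d (\<lambda>z. ln (theta (\<i> * pi * (cnj z + z - of_real h) / h) (exp (- pi\<^sup>2 / h)))) z a b)"
      unfolding dbar_d_log_dual(1)[OF h refl] using w[OF h] by (simp add: Q_def fun_eq_iff)
    show "dm h = density dm0 (\<lambda>z. ennreal (1 +
        Re (theta_tail (\<i> * pi / h * (cnj z + z - of_real h)) (exp (- pi\<^sup>2 / h)))))"
      unfolding tail[OF h] m[OF h] m0 by simp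
  qed (fact w0 forms_differ form_bound box_bound measures_differ tail_small measure_bound)+
qed

end
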